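(* Let $|\phi|<1$, $|\rho|<1$, $\sigma_\xi>0$, and let $(Y_t)_{t\ge 0}$ be a Markov DIG-AR(1) process with parameters $\phi,\rho,\sigma_\xi$. Let $V_t$ denote the standard deviation of $Y_t$, and for $T\ge 2$ set $$\tilde\phi_T=\hat\phi_T-\rho\,\sigma_\xi\,\frac{\sum_{t=2}^{T}\frac{Y_{t-1}^2}{V_{t-1}}}{\sum_{t=2}^{T}Y_{t-1}^2},\qquad \hat\phi_T=\frac{\sum_{t=2}^{T}Y_tY_{t-1}}{\sum_{t=2}^{T}Y_{t-1}^2}.$$ Then, as $T\to+\infty$, $\sqrt{T}\,(\tilde\phi_T-\phi)$ converges in distribution to a centered normal random variable with standard deviation $$\bar\eta=\frac{\sigma_\xi\sqrt{1-\rho^2}}{\bar V(\rho,\phi)},\qquad \bar V(\rho,\phi)=\frac{\sigma_\xi\left(\rho\phi+\sqrt{\rho^2\phi^2+1-\phi^2}\right)}{1-\phi^2},$$ i.e. to a normal random variable with mean $0$ and variance $\bar\eta^2$.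
   Context: A dependent innovations gaussian AR(1) process (DIG-AR(1)) with parameters $\phi,\rho,\sigma_\xi$ ($|\phi|<1$, $|\rho|<1$, $\sigma_\xi>0$) is a discrete-time real stochastic process on a probability space, $Y_t=\phi Y_{t-1}+\xi_t$ for $t\ge 1$, where $Y_0=0$ a.s., the $\xi_t$ are identically distributed (not assumed independent) with $\xi_t\sim N(0,\sigma_\xi^2)$ (variance $\sigma_\xi^2$), and for every $t$ the copula associated with $(\xi_t,Y_{t-1})$ is the gaussian copula with time-invariant parameter (correlation) $\rho$. For $t=1$ the copula condition is no restriction because $Y_0$ is constant. It is called a Markov DIG-AR(1) process if moreover $(Y_t)_t$ is a Markov process with respect to its own filtration. The estimator $\hat\phi_T$ is the OLS estimator of $\phi$; $\tilde\phi_T$ is called an infeasible estimator since it involves $\rho$, $\sigma_\xi$ and $V_t$. *)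

theory Defs
  imports "HOL-Probability.Probability"
begin

definition binormal_density :: "real \<Rightarrow> real \<times> real \<Rightarrow> real" where
  "binormal_density \<rho> = (\<lambda>(x, y).
     exp (- (x\<^sup>2 - 2 * \<rho> * x * y + y\<^sup>2) / (2 * (1 - \<rho>\<^sup>2))) / (2 * pi * sqrt (1 - \<rho>\<^sup>2)))"

definition binormal_cdf :: "real \<Rightarrow> real \<Rightarrow> real \<Rightarrow> real" where
  "binormal_cdf \<rho> x y =
     measure (density (lborel \<Otimes>\<^sub>M lborel) (\<lambda>z. ennreal (binormal_density \<rho> z))) ({..x} \<times> {..y})"

text \<open>On the open unit square this is the usual formula
  \<open>\<Phi>\<^sub>\<rho> (\<Phi>\<^sup>-\<^sup>1 u) (\<Phi>\<^sup>-\<^sup>1 v)\<close>; since the standard normal quantile function is real-valued only on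
  \<open>{0<..<1}\<close>, the values on the boundary (the same for every copula) are given separately.
  Only arguments in the closed unit square matter.\<close>

definition gaussian_copula :: "real \<Rightarrow> real \<Rightarrow> real \<Rightarrow> real" where
  "gaussian_copula \<rho> u v =
     (if u = 0 \<or> v = 0 then 0
      else if u = 1 then v
      else if v = 1 then u
      else binormal_cdf \<rho> (inv (cdf std_normal_distribution) u)
                          (inv (cdf std_normal_distribution) v))"

text \<open>\<open>C\<close> is a copula associated with \<open>(X, Z)\<close> in the sense of Sklar's theorem. It is unique only
  when both marginals are continuous; if \<open>Z\<close> is almost surely constant, every copula qualifies.\<close>

definition has_copula ::
  "'a measure \<Rightarrow> ('a \<Rightarrow> real) \<Rightarrow> ('a \<Rightarrow> real) \<Rightarrow> (real \<Rightarrow> real \<Rightarrow> real) \<Rightarrow> bool" where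
  "has_copula M X Z C \<longleftrightarrow>
     (\<forall>x z. measure M {\<omega> \<in> space M. X \<omega> \<le> x \<and> Z \<omega> \<le> z} =
            C (cdf (distr M borel X) x) (cdf (distr M borel Z) z))"

definition natural_filtration :: "'a measure \<Rightarrow> (nat \<Rightarrow> 'a \<Rightarrow> real) \<Rightarrow> nat \<Rightarrow> 'a measure" where
  "natural_filtration M Y t =
     sigma (space M) {Y s -` A \<inter> space M | s A. s \<le> t \<and> A \<in> sets borel}"

definition markov_process :: "'a measure \<Rightarrow> (nat \<Rightarrow> 'a \<Rightarrow> real) \<Rightarrow> bool" where
  "markov_process M Y \<longleftrightarrow>
     (\<forall>s t. \<forall>A \<in> sets borel. s \<le> t \<longrightarrow>
        (AE \<omega> in M.
           real_cond_exp M (natural_filtration M Y s) (indicator (Y t -` A \<inter> space M)) \<omega> =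
           real_cond_exp M (vimage_algebra (space M) (Y s) borel)
             (indicator (Y t -` A \<inter> space M)) \<omega>))"

text \<open>The innovations \<open>\<xi> t\<close> are used for \<open>t \<ge> 1\<close> only; \<open>\<xi> 0\<close> is unconstrained.\<close>

locale dig_ar1 = prob_space M
  for M :: "'a measure" and \<phi> \<rho> \<sigma> :: real and Y \<xi> :: "nat \<Rightarrow> 'a \<Rightarrow> real" +
  assumes phi: "\<bar>\<phi>\<bar> < 1"
    and rho: "\<bar>\<rho>\<bar> < 1"
    and sigma: "\<sigma> > 0"
    and Y_measurable: "\<And>t. random_variable borel (Y t)"
    and Y_0: "AE \<omega> in M. Y 0 \<omega> = 0"
    and Y_step: "\<And>t. t \<ge> 1 \<Longrightarrow> AE \<omega> in M. Y t \<omega> = \<phi> * Y (t - 1) \<omega> + \<xi> t \<omega>"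
    and innovations: "\<And>t. t \<ge> 1 \<Longrightarrow> distributed M lborel (\<xi> t) (normal_density 0 \<sigma>)"
    and copula: "\<And>t. t \<ge> 1 \<Longrightarrow> has_copula M (\<xi> t) (Y (t - 1)) (gaussian_copula \<rho>)"

locale markov_dig_ar1 = dig_ar1 +
  assumes markov: "markov_process M Y"

definition std_dev :: "'a measure \<Rightarrow> ('a \<Rightarrow> real) \<Rightarrow> real" where
  "std_dev M X = sqrt (prob_space.variance M X)"

definition phi_hat :: "(nat \<Rightarrow> 'a \<Rightarrow> real) \<Rightarrow> nat \<Rightarrow> 'a \<Rightarrow> real" where
  "phi_hat Y T \<omega> = (\<Sum>t=2..T. Y t \<omega> * Y (t - 1) \<omega>) / (\<Sum>t=2..T. (Y (t - 1) \<omega>)\<^sup>2)"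

definition phi_tilde ::
  "'a measure \<Rightarrow> real \<Rightarrow> real \<Rightarrow> (nat \<Rightarrow> 'a \<Rightarrow> real) \<Rightarrow> nat \<Rightarrow> 'a \<Rightarrow> real" where
  "phi_tilde M \<rho> \<sigma> Y T \<omega> =
     phi_hat Y T \<omega> -
     \<rho> * \<sigma> * ((\<Sum>t=2..T. (Y (t - 1) \<omega>)\<^sup>2 / std_dev M (Y (t - 1))) / (\<Sum>t=2..T. (Y (t - 1) \<omega>)\<^sup>2))"

definition V_bar :: "real \<Rightarrow> real \<Rightarrow> real \<Rightarrow> real" where
  "V_bar \<sigma> \<rho> \<phi> = \<sigma> * (\<rho> * \<phi> + sqrt (\<rho>\<^sup>2 * \<phi>\<^sup>2 + 1 - \<phi>\<^sup>2)) / (1 - \<phi>\<^sup>2)"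

definition eta_bar :: "real \<Rightarrow> real \<Rightarrow> real \<Rightarrow> real" where
  "eta_bar \<sigma> \<rho> \<phi> = \<sigma> * sqrt (1 - \<rho>\<^sup>2) / V_bar \<sigma> \<rho> \<phi>"

end

theory Submission
  imports Defs
begin

text \<open>
  The copula condition says that \<open>\<xi> t\<close> and \<open>Y (t - 1)\<close> are jointly gaussian with correlation \<open>\<rho>\<close>, as
  long as \<open>Y (t - 1)\<close> is a nondegenerate centred normal variable. Regressing \<open>\<xi> t\<close> on \<open>Y (t - 1)\<close> then
  gives \<open>Y t = \<alpha> * Y (t - 1) + \<tau> * e\<close>, where \<open>\<alpha> = \<phi> + \<rho> * \<sigma> / V\<close> for the standard deviation \<open>V\<close> of
  \<open>Y (t - 1)\<close>, where \<open>\<tau> = \<sigma> * sqrt (1 - \<rho>\<^sup>2)\<close>, and where \<open>e\<close> is standard normal and independent of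
  \<open>Y (t - 1)\<close> (\<open>copula_innovation\<close>). By the Markov property \<open>e\<close> is even independent of the whole past
  (\<open>innovation_indep_of_past\<close>). Hence \<open>Y\<close> is an autoregression driven by independent normal noise, with
  deterministic time-varying coefficients, and the infeasible estimator is the one that uses the
  right coefficients: with \<open>S\<close> the sum of the products \<open>Y (t - 1) * e\<close> and \<open>Q\<close> the sum of the squares
  \<open>(Y (t - 1))\<^sup>2\<close>, its error is \<open>\<tau> * S / Q\<close> (\<open>phi_tilde_error\<close>).

  The standard deviations satisfy \<open>V' = sqrt ((\<phi> * V + \<rho> * \<sigma>)\<^sup>2 + \<tau>\<^sup>2)\<close>, a contraction with factor
  \<open>\<bar>\<phi>\<bar>\<close> whose fixed point is \<open>V_bar\<close> (\<open>volatility_tendsto\<close>). So the coefficients converge to a limit \<open>a\<close> with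
  \<open>1 - a\<^sup>2 = \<tau>\<^sup>2 / V_bar\<^sup>2\<close>, which is the variance in the limit theorem.

  Two facts give that theorem. The law of large numbers \<open>Q / T \<longlongrightarrow> c = \<tau>\<^sup>2 / (1 - a\<^sup>2)\<close>
  holds in mean (\<open>law_of_large_numbers\<close>): squaring the recursion and summing over time expresses
  \<open>(1 - a\<^sup>2) * Q\<close> as \<open>T * \<tau>\<^sup>2\<close> up to boundary terms, averages of a null sequence, and sums of
  orthogonal martingale differences. For the central limit theorem no Lindeberg argument is needed, because the noise is
  gaussian: \<open>exp (\<i> * t * S + t\<^sup>2 * Q / 2)\<close> has expectation exactly 1 once \<open>S\<close> and \<open>Q\<close> are stopped before \<open>Q\<close>
  becomes large, which provides integrability (\<open>exponential_martingale\<close>). Take \<open>t\<close> proportional to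
  \<open>1 / sqrt T\<close>. Since \<open>Q / T\<close> is close to \<open>c\<close>, stopping rarely matters, the factor \<open>exp (t\<^sup>2 * Q / 2)\<close> is nearly constant, and the
  characteristic function of \<open>S / sqrt T\<close> is close to that of a normal variable with variance \<open>c\<close>
  (\<open>char_transform_error\<close>). Replacing \<open>Q / T\<close> by \<open>c\<close> in the quotient
  (\<open>slutsky_quotient_bound\<close>) and applying Levy's continuity theorem finishes the proof.
\<close>

section \<open>Random variables independent of a sigma-algebra\<close>

text \<open>
  The relation \<open>indep_var\<close> requires both variables to take values in the same type, so it cannot
  relate \<open>e\<close> to the identity map into \<open>G\<close>; hence this form with events.
\<close>

definition (in prob_space) indep_of_algebra :: "'a measure \<Rightarrow> ('a \<Rightarrow> real) \<Rightarrow> bool" where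
  "indep_of_algebra G e \<longleftrightarrow> subalgebra M G \<and> random_variable borel e \<and>
     (\<forall>B \<in> sets G. \<forall>E \<in> sets borel.
        prob (B \<inter> (e -` E \<inter> space M)) = prob B * prob (e -` E \<inter> space M))"

context prob_space
begin

lemma indep_of_algebra_joint_law:
  assumes "indep_of_algebra G e"
  shows "distr M G (\<lambda>\<omega>. \<omega>) \<Otimes>\<^sub>M distr M borel e = distr M (G \<Otimes>\<^sub>M borel) (\<lambda>\<omega>. (\<omega>, e \<omega>))"
proof -
  have sub: "subalgebra M G" and e[measurable]: "random_variable borel e"
    and ind: "\<And>B E. B \<in> sets G \<Longrightarrow> E \<in> sets borel \<Longrightarrow>
        prob (B \<inter> (e -` E \<inter> space M)) = prob B * prob (e -` E \<inter> space M)"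
    using assms by (auto simp: indep_of_algebra_def)
  have id[measurable]: "(\<lambda>\<omega>. \<omega>) \<in> measurable M G"
    by (rule measurable_from_subalg[OF sub measurable_ident_sets[OF refl]])
  interpret A: prob_space "distr M G (\<lambda>\<omega>. \<omega>)" by (rule prob_space_distr) (rule id)
  interpret B: prob_space "distr M borel e" by (rule prob_space_distr) (rule e)
  show ?thesis
  proof (rule pair_measure_eqI)
    show "sigma_finite_measure (distr M G (\<lambda>\<omega>. \<omega>))" "sigma_finite_measure (distr M borel e)" by unfold_locales
    show "sets (distr M G (\<lambda>\<omega>. \<omega>) \<Otimes>\<^sub>M distr M borel e) = sets (distr M (G \<Otimes>\<^sub>M borel) (\<lambda>\<omega>. (\<omega>, e \<omega>)))"
      by (simp cong: sets_pair_measure_cong)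
    fix B E assume "B \<in> sets (distr M G (\<lambda>\<omega>. \<omega>))" "E \<in> sets (distr M borel e)"
    then have BE[measurable]: "B \<in> sets G" "E \<in> sets borel" by auto
    have sp: "B \<subseteq> space M" using sets.sets_into_space[OF BE(1)] sub by (simp add: subalgebra_def)
    have "emeasure (distr M (G \<Otimes>\<^sub>M borel) (\<lambda>\<omega>. (\<omega>, e \<omega>))) (B \<times> E) =
        emeasure M ((\<lambda>\<omega>. (\<omega>, e \<omega>)) -` (B \<times> E) \<inter> space M)"
      by (rule emeasure_distr) measurable
    also have "(\<lambda>\<omega>. (\<omega>, e \<omega>)) -` (B \<times> E) \<inter> space M = B \<inter> (e -` E \<inter> space M)" using sp by auto
    also have "emeasure M \<dots> = emeasure M B * emeasure M (e -` E \<inter> space M)"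
      using ind[OF BE] by (simp add: emeasure_eq_measure ennreal_mult)
    also have "\<dots> = emeasure (distr M G (\<lambda>\<omega>. \<omega>)) B * emeasure (distr M borel e) E"
      using sp by (simp add: emeasure_distr Int_absorb2)
    finally show "emeasure (distr M G (\<lambda>\<omega>. \<omega>)) B * emeasure (distr M borel e) E =
        emeasure (distr M (G \<Otimes>\<^sub>M borel) (\<lambda>\<omega>. (\<omega>, e \<omega>))) (B \<times> E)" by simp
  qed
qed

text \<open>
  A function of the past and of a fresh variable may be integrated over the fresh variable first, with
  the past frozen. This replaces conditioning on \<open>G\<close> in the martingale arguments below.
\<close>

lemma integral_freezing:
  fixes f :: "'a \<Rightarrow> real \<Rightarrow> 'b :: {banach, second_countable_topology}"
  assumes ind: "indep_of_algebra G e"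
    and f: "case_prod f \<in> borel_measurable (G \<Otimes>\<^sub>M borel)"
    and int: "integrable M (\<lambda>\<omega>. f \<omega> (e \<omega>))"
  shows "(\<integral>\<omega>. f \<omega> (e \<omega>) \<partial>M) = (\<integral>\<omega>. (\<integral>x. f \<omega> x \<partial>distr M borel e) \<partial>M)"
proof -
  have rv: "(\<lambda>\<omega>. \<omega>) \<in> measurable M G" "e \<in> borel_measurable M"
    using ind measurable_from_subalg[OF _ measurable_ident_sets[OF refl]] by (auto simp: indep_of_algebra_def)
  note eq = indep_of_algebra_joint_law[OF ind]
  interpret A: prob_space "distr M G (\<lambda>\<omega>. \<omega>)" by (rule prob_space_distr) (rule rv)
  interpret B: prob_space "distr M borel e" by (rule prob_space_distr) (rule rv)
  interpret P: pair_prob_space "distr M G (\<lambda>\<omega>. \<omega>)" "distr M borel e" ..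
  have pm: "(\<lambda>\<omega>. (\<omega>, e \<omega>)) \<in> measurable M (G \<Otimes>\<^sub>M borel)"
    using rv by (rule measurable_Pair)
  have f': "case_prod f \<in> borel_measurable (distr M G (\<lambda>\<omega>. \<omega>) \<Otimes>\<^sub>M distr M borel e)"
    using f by (simp cong: measurable_cong_sets sets_pair_measure_cong)
  have i: "integrable (distr M G (\<lambda>\<omega>. \<omega>) \<Otimes>\<^sub>M distr M borel e) (case_prod f)"
    unfolding eq using int by (subst integrable_distr_eq[OF pm f]) simp
  have mI: "(\<lambda>\<omega>. \<integral>x. f \<omega> x \<partial>distr M borel e) \<in> borel_measurable (distr M G (\<lambda>\<omega>. \<omega>))"
    using B.borel_measurable_lebesgue_integral[OF f'] by simp
  have "(\<integral>\<omega>. f \<omega> (e \<omega>) \<partial>M) = integral\<^sup>L (distr M (G \<Otimes>\<^sub>M borel) (\<lambda>\<omega>. (\<omega>, e \<omega>))) (case_prod f)"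
    by (subst integral_distr[OF pm f]) simp
  also have "\<dots> = (\<integral>\<omega>. (\<integral>x. f \<omega> x \<partial>distr M borel e) \<partial>distr M G (\<lambda>\<omega>. \<omega>))"
    unfolding eq[symmetric] by (rule P.integral_fst'[OF i, symmetric, simplified])
  also have "\<dots> = (\<integral>\<omega>. (\<integral>x. f \<omega> x \<partial>distr M borel e) \<partial>M)"
    using mI by (intro integral_distr rv) simp
  finally show ?thesis .
qed

lemma indep_of_algebra_imp_indep_var:
  assumes ind: "indep_of_algebra G e" and H: "H \<in> borel_measurable G"
  shows "indep_var borel H borel e"
  unfolding indep_var_eq
proof (intro conjI indep_set_sigma_sets)
  have sub: "subalgebra M G" and e[measurable]: "random_variable borel e"
    using ind by (auto simp: indep_of_algebra_def)
  show [measurable]: "random_variable borel H" by (rule measurable_from_subalg[OF sub H])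
  show "random_variable borel e" by fact
  have HG: "H -` A \<inter> space M \<in> sets G" if "A \<in> sets borel" for A
    using measurable_sets[OF H that] sub by (simp add: subalgebra_def)
  show "indep_set {H -` A \<inter> space M | A. A \<in> sets borel} {e -` A \<inter> space M | A. A \<in> sets borel}"
    by (rule indep_setI) (use ind HG in \<open>auto simp: indep_of_algebra_def\<close>)
  have stable: "Int_stable {f -` A \<inter> space M | A. A \<in> sets borel}" for f :: "'a \<Rightarrow> real"
  proof (rule Int_stableI)
    fix a b assume "a \<in> {f -` A \<inter> space M | A. A \<in> sets borel}" "b \<in> {f -` A \<inter> space M | A. A \<in> sets borel}"
    then obtain A B where "a = f -` A \<inter> space M" "b = f -` B \<inter> space M" "A \<in> sets borel" "B \<in> sets borel" by auto
    then show "a \<inter> b \<in> {f -` A \<inter> space M | A. A \<in> sets borel}" by (auto intro!: exI[of _ "A \<inter> B"])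
  qed
  show "Int_stable {H -` A \<inter> space M | A. A \<in> sets borel}"
    "Int_stable {e -` A \<inter> space M | A. A \<in> sets borel}" by (rule stable)+
qed

end

lemma (in prob_space) abs_mean_le_sqrt_second_moment:
  fixes X :: "'a \<Rightarrow> real"
  assumes [measurable]: "random_variable borel X" and int: "integrable M (\<lambda>\<omega>. (X \<omega>)\<^sup>2)"
  shows "integrable M X" "expectation (\<lambda>\<omega>. \<bar>X \<omega>\<bar>) \<le> sqrt (expectation (\<lambda>\<omega>. (X \<omega>)\<^sup>2))"
proof -
  show X: "integrable M X" by (rule square_integrable_imp_integrable) (use int in auto)
  have "variance (\<lambda>\<omega>. \<bar>X \<omega>\<bar>) = expectation (\<lambda>\<omega>. (\<bar>X \<omega>\<bar>)\<^sup>2) - (expectation (\<lambda>\<omega>. \<bar>X \<omega>\<bar>))\<^sup>2"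
    using X int by (intro variance_eq) auto
  then have "(expectation (\<lambda>\<omega>. \<bar>X \<omega>\<bar>))\<^sup>2 \<le> expectation (\<lambda>\<omega>. (X \<omega>)\<^sup>2)"
    using variance_positive[of "\<lambda>\<omega>. \<bar>X \<omega>\<bar>"] by simp
  then show "expectation (\<lambda>\<omega>. \<bar>X \<omega>\<bar>) \<le> sqrt (expectation (\<lambda>\<omega>. (X \<omega>)\<^sup>2))"
    by (simp add: real_le_rsqrt)
qed

lemma integrable_mult_of_squares:
  fixes f g :: "'a \<Rightarrow> real"
  assumes [measurable]: "f \<in> borel_measurable M" "g \<in> borel_measurable M"
    and "integrable M (\<lambda>x. (f x)\<^sup>2)" "integrable M (\<lambda>x. (g x)\<^sup>2)"
  shows "integrable M (\<lambda>x. f x * g x)"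
proof (rule Bochner_Integration.integrable_bound)
  show "integrable M (\<lambda>x. (f x)\<^sup>2 + (g x)\<^sup>2)" using assms by auto
  have "\<bar>a * b\<bar> \<le> a\<^sup>2 + b\<^sup>2" for a b :: real
    using sum_squares_bound[of "\<bar>a\<bar>" "\<bar>b\<bar>"] abs_ge_zero[of "a*b"] unfolding abs_mult power2_abs by linarith
  then show "AE x in M. norm (f x * g x) \<le> norm ((f x)\<^sup>2 + (g x)\<^sup>2)" by simp
qed simp

text \<open>
  Only the finitely many terms before \<open>f\<close> gets small resist, and dividing by \<open>Suc N\<close> makes their sum negligible.
\<close>

lemma Cesaro_zero:
  fixes f :: "nat \<Rightarrow> real"
  assumes "f \<longlonglongrightarrow> 0"
  shows "(\<lambda>N. (\<Sum>n<N. f n) / real (Suc N)) \<longlonglongrightarrow> 0"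
proof (rule LIMSEQ_I)
  fix r :: real assume r: "r > 0"
  obtain k where k: "\<And>n. n \<ge> k \<Longrightarrow> \<bar>f n\<bar> < r / 2"
    using LIMSEQ_D[OF assms, of "r / 2"] r by auto
  define C where "C = (\<Sum>n<k. \<bar>f n\<bar>)"
  have "(\<lambda>N. C / real (Suc N)) \<longlonglongrightarrow> 0"
    using tendsto_mult_right_zero[OF LIMSEQ_inverse_real_of_nat, of C] by (simp add: field_simps)
  from LIMSEQ_D[OF this, of "r / 2"] r obtain m where
    m: "\<And>N. N \<ge> m \<Longrightarrow> \<bar>C / real (Suc N)\<bar> < r / 2" by auto
  show "\<exists>no. \<forall>N\<ge>no. norm ((\<Sum>n<N. f n) / real (Suc N) - 0) < r"
  proof (intro exI allI impI)
    fix N assume N: "max k m \<le> N"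
    have "\<bar>\<Sum>n<N. f n\<bar> \<le> (\<Sum>n<N. \<bar>f n\<bar>)" by (rule sum_abs)
    also have "\<dots> = C + (\<Sum>n=k..<N. \<bar>f n\<bar>)"
      using N unfolding C_def lessThan_atLeast0 by (simp add: sum.atLeastLessThan_concat)
    also have "(\<Sum>n=k..<N. \<bar>f n\<bar>) \<le> (\<Sum>n=k..<N. r / 2)"
      using k by (intro sum_mono) (auto intro: less_imp_le)
    also have "\<dots> \<le> real (Suc N) * (r / 2)" using r by (simp add: mult_right_mono)
    finally have "\<bar>\<Sum>n<N. f n\<bar> / real (Suc N) \<le> (C + real (Suc N) * (r / 2)) / real (Suc N)"
      by (intro divide_right_mono) auto
    also have "\<dots> = C / real (Suc N) + r / 2" by (subst add_divide_distrib, subst nonzero_mult_div_cancel_left) simp_all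
    also have "\<dots> < r" using m[of N] N by linarith
    finally show "norm ((\<Sum>n<N. f n) / real (Suc N) - 0) < r" by simp
  qed
qed

section \<open>Martingale transforms of gaussian noise\<close>

text \<open>
  Here \<open>G n\<close> is the past before \<open>e n\<close>; \<open>e n\<close> itself belongs to \<open>G (Suc n)\<close>. A process is predictable when its \<open>n\<close>-th
  member is measurable with respect to \<open>G n\<close>.
\<close>

locale gaussian_noise = prob_space M for M :: "'a measure" +
  fixes G :: "nat \<Rightarrow> 'a measure" and e :: "nat \<Rightarrow> 'a \<Rightarrow> real"
  assumes subalg: "\<And>n. subalgebra M (G n)"
    and mono: "\<And>n. sets (G n) \<subseteq> sets (G (Suc n))"
    and adapted: "\<And>n. e n \<in> borel_measurable (G (Suc n))"
    and indep: "\<And>n. indep_of_algebra (G n) (e n)"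
    and distr_e: "\<And>n. distr M borel (e n) = std_normal_distribution"
begin

lemma G_measurable: "f \<in> measurable (G n) N \<Longrightarrow> f \<in> measurable M N"
  by (rule measurable_from_subalg[OF subalg])

lemma G_measurable_Suc: "f \<in> measurable (G n) N \<Longrightarrow> f \<in> measurable (G (Suc n)) N"
  using subalg[of n] subalg[of "Suc n"] mono[of n]
  by (intro measurable_from_subalg[of "G (Suc n)" "G n"]) (auto simp: subalgebra_def)

lemma e_measurable [measurable]: "e n \<in> borel_measurable M"
  by (rule G_measurable[OF adapted])

lemma expectation_fresh:
  fixes g :: "real \<Rightarrow> real"
  assumes "integrable std_normal_distribution g"
  shows "integrable M (\<lambda>\<omega>. g (e n \<omega>))" "expectation (\<lambda>\<omega>. g (e n \<omega>)) = integral\<^sup>L std_normal_distribution g"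
proof -
  have [measurable]: "g \<in> borel_measurable borel"
    using borel_measurable_integrable[OF assms] by simp
  show "integrable M (\<lambda>\<omega>. g (e n \<omega>))"
    using integrable_distr_eq[of "e n" M borel g] assms distr_e[of n] by simp
  show "expectation (\<lambda>\<omega>. g (e n \<omega>)) = integral\<^sup>L std_normal_distribution g"
    using integral_distr[of "e n" M borel g] distr_e[of n] by simp
qed

lemma expectation_past_times_fresh:
  fixes g :: "real \<Rightarrow> real"
  assumes H: "H \<in> borel_measurable (G n)" "integrable M H"
    and g: "integrable std_normal_distribution g"
  shows "integrable M (\<lambda>\<omega>. H \<omega> * g (e n \<omega>))"
    "expectation (\<lambda>\<omega>. H \<omega> * g (e n \<omega>)) = expectation H * integral\<^sup>L std_normal_distribution g"
proof -
  have [measurable]: "g \<in> borel_measurable borel"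
    using borel_measurable_integrable[OF g] by simp
  have iv: "indep_var borel H borel (\<lambda>\<omega>. g (e n \<omega>))"
    using indep_var_compose[OF indep_of_algebra_imp_indep_var[OF indep H(1)], of "\<lambda>x. x" borel g borel] by (simp add: comp_def)
  show "integrable M (\<lambda>\<omega>. H \<omega> * g (e n \<omega>))"
    by (rule indep_var_integrable[OF iv H(2) expectation_fresh(1)[OF g]])
  show "expectation (\<lambda>\<omega>. H \<omega> * g (e n \<omega>)) = expectation H * integral\<^sup>L std_normal_distribution g"
    by (subst indep_var_lebesgue_integral[OF iv H(2) expectation_fresh(1)[OF g]])
       (simp add: expectation_fresh(2)[OF g])
qed

text \<open>
  The summands are orthogonal: expanding the square, each cross term contains a factor \<open>g (e n)\<close> that
  is centred and independent of everything else in it.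
\<close>

lemma transform_second_moment:
  fixes g :: "real \<Rightarrow> real"
  assumes H: "\<And>n. H n \<in> borel_measurable (G n)" "\<And>n. integrable M (\<lambda>\<omega>. (H n \<omega>)\<^sup>2)"
    and g: "integrable std_normal_distribution g" "integral\<^sup>L std_normal_distribution g = 0"
      "integrable std_normal_distribution (\<lambda>x. (g x)\<^sup>2)"
  defines "A \<equiv> \<lambda>N \<omega>. \<Sum>n<N. H n \<omega> * g (e n \<omega>)"
  shows "A N \<in> borel_measurable (G N)" (is ?m)
    and "integrable M (\<lambda>\<omega>. (A N \<omega>)\<^sup>2)" (is ?i)
    and "expectation (\<lambda>\<omega>. (A N \<omega>)\<^sup>2) =
      (\<integral>x. (g x)\<^sup>2 \<partial>std_normal_distribution) * (\<Sum>n<N. expectation (\<lambda>\<omega>. (H n \<omega>)\<^sup>2))" (is ?e)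
proof -
  have gm[measurable]: "g \<in> borel_measurable borel"
    using borel_measurable_integrable[OF g(1)] by simp
  have "?m \<and> ?i \<and> ?e"
  proof (induction N)
    case 0 then show ?case by (simp add: A_def)
  next
    case (Suc N)
    then have AN: "A N \<in> borel_measurable (G N)" "integrable M (\<lambda>\<omega>. (A N \<omega>)\<^sup>2)" by auto
    have AS: "A (Suc N) \<omega> = A N \<omega> + H N \<omega> * g (e N \<omega>)" for \<omega> by (simp add: A_def)
    note [measurable] = G_measurable_Suc[OF AN(1)] G_measurable_Suc[OF H(1)[of N]] adapted[of N]
    have m: "A (Suc N) \<in> borel_measurable (G (Suc N))" unfolding AS[abs_def] by measurable
    have "integrable M (\<lambda>\<omega>. A N \<omega> * H N \<omega>)"
      by (intro integrable_mult_of_squares AN H G_measurable[OF AN(1)] G_measurable[OF H(1)])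
    moreover have "(\<lambda>\<omega>. A N \<omega> * H N \<omega>) \<in> borel_measurable (G N)" using AN H(1)[of N] by measurable
    ultimately have i1: "integrable M (\<lambda>\<omega>. (A N \<omega> * H N \<omega>) * g (e N \<omega>))"
        "expectation (\<lambda>\<omega>. (A N \<omega> * H N \<omega>) * g (e N \<omega>)) = 0"
      using expectation_past_times_fresh[of _ N g] g by auto
    have i2: "integrable M (\<lambda>\<omega>. (H N \<omega>)\<^sup>2 * (g (e N \<omega>))\<^sup>2)"
        "expectation (\<lambda>\<omega>. (H N \<omega>)\<^sup>2 * (g (e N \<omega>))\<^sup>2) =
         expectation (\<lambda>\<omega>. (H N \<omega>)\<^sup>2) * (\<integral>x. (g x)\<^sup>2 \<partial>std_normal_distribution)"
      using expectation_past_times_fresh[of "\<lambda>\<omega>. (H N \<omega>)\<^sup>2" N "\<lambda>x. (g x)\<^sup>2"] g H[of N] by auto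
    have sq: "(A (Suc N) \<omega>)\<^sup>2 = (A N \<omega>)\<^sup>2 + (2 * ((A N \<omega> * H N \<omega>) * g (e N \<omega>)) + (H N \<omega>)\<^sup>2 * (g (e N \<omega>))\<^sup>2)" for \<omega>
      unfolding AS by (simp add: power2_eq_square algebra_simps)
    show ?case using m i1 i2 AN Suc by (simp add: sq distrib_left)
  qed
  then show ?m ?i ?e by auto
qed

end

section \<open>The exponential martingale of a gaussian transform\<close>

lemma norm_iexp_diff_le: "cmod (iexp x - iexp y) \<le> \<bar>x - y\<bar>"
proof -
  have "iexp x - iexp y = iexp y * (iexp (x - y) - 1)"
    by (simp add: algebra_simps flip: exp_add)
  then have "cmod (iexp x - iexp y) = cmod (iexp (x - y) - 1)" by (simp add: norm_mult)
  also have "\<dots> \<le> \<bar>x - y\<bar>" using iexp_approx1[of "x - y" 0] by simp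
  finally show ?thesis .
qed

lemma norm_iexp_diff_le_2: "cmod (iexp x - iexp y) \<le> 2"
  by (rule order_trans[OF norm_triangle_ineq4]) simp

context gaussian_noise
begin

text \<open>
  With the past frozen, integrating \<open>iexp (t * H n * e n)\<close> gives the standard normal characteristic function at \<open>t * H n\<close>, which the
  factor \<open>exp (t\<^sup>2 / 2 * (H n)\<^sup>2)\<close> cancels. The bound \<open>K\<close> keeps these variables bounded, hence integrable.
\<close>

lemma exponential_martingale:
  fixes t :: real
  assumes H: "\<And>n. H n \<in> borel_measurable (G n)"
    and bound: "\<And>N \<omega>. (\<Sum>n<N. (H n \<omega>)\<^sup>2) \<le> K"
  shows "expectation (\<lambda>\<omega>. iexp (t * (\<Sum>n<N. H n \<omega> * e n \<omega>)) *
           complex_of_real (exp (t\<^sup>2 / 2 * (\<Sum>n<N. (H n \<omega>)\<^sup>2)))) = 1"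
proof -
  define Z where "Z N \<omega> = iexp (t * (\<Sum>n<N. H n \<omega> * e n \<omega>)) *
           complex_of_real (exp (t\<^sup>2 / 2 * (\<Sum>n<N. (H n \<omega>)\<^sup>2)))" for N \<omega>
  have HN: "H n \<in> borel_measurable (G (n + k))" for n k
    by (induction k) (auto intro: H G_measurable_Suc)
  have HN': "H n \<in> borel_measurable (G N)" if "n \<le> N" for n N using HN[of n "N - n"] that by simp
  have eN: "e n \<in> borel_measurable (G (Suc n + k))" for n k
    by (induction k) (auto intro: adapted G_measurable_Suc)
  have eN': "e n \<in> borel_measurable (G N)" if "n < N" for n N using eN[of n "N - Suc n"] that by simp
  have Zm: "Z N \<in> borel_measurable (G N)" for N
    unfolding Z_def[abs_def] using HN' eN' by measurable
  have bd: "cmod (Z N \<omega>) \<le> exp (t\<^sup>2 / 2 * K)" for N \<omega>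
    unfolding Z_def norm_mult norm_exp_i_times using bound[of \<omega> N]
    by (auto intro!: mult_left_mono)
  have Zi: "integrable M (Z N)" for N
    by (rule integrable_const_bound[of _ "exp (t\<^sup>2 / 2 * K)"]) (use bd G_measurable[OF Zm] in auto)
  have "expectation (Z N) = 1" for N
  proof (induction N)
    case 0 show ?case by (simp add: Z_def[abs_def] prob_space)
  next
    case (Suc N)
    define f where "f \<omega> x = Z N \<omega> * complex_of_real (exp (t\<^sup>2 / 2 * (H N \<omega>)\<^sup>2)) * iexp (t * H N \<omega> * x)" for \<omega> x
    have ZS: "Z (Suc N) \<omega> = f \<omega> (e N \<omega>)" for \<omega>
      unfolding Z_def f_def by (simp add: distrib_left exp_add of_real_add mult_ac)
    note [measurable] = Zm[of N] H[of N]
    have fm: "case_prod f \<in> borel_measurable (G N \<Otimes>\<^sub>M borel)"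
      unfolding f_def case_prod_beta' by measurable
    have int: "integrable M (\<lambda>\<omega>. f \<omega> (e N \<omega>))" using Zi[of "Suc N"] by (simp add: ZS[abs_def])
    have inner: "(\<integral>x. f \<omega> x \<partial>std_normal_distribution) = Z N \<omega>" for \<omega>
    proof -
      have "(\<integral>x. f \<omega> x \<partial>std_normal_distribution) =
          Z N \<omega> * complex_of_real (exp (t\<^sup>2 / 2 * (H N \<omega>)\<^sup>2)) * char std_normal_distribution (t * H N \<omega>)"
        unfolding f_def char_def by simp
      also have "char std_normal_distribution (t * H N \<omega>) = complex_of_real (exp (- (t * H N \<omega>)\<^sup>2 / 2))"
        by (simp add: char_std_normal_distribution)
      also have "Z N \<omega> * complex_of_real (exp (t\<^sup>2 / 2 * (H N \<omega>)\<^sup>2)) * complex_of_real (exp (- (t * H N \<omega>)\<^sup>2 / 2)) = Z N \<omega>"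
        by (simp add: mult.assoc power_mult_distrib flip: of_real_mult exp_add)
      finally show ?thesis .
    qed
    have "expectation (Z (Suc N)) = (\<integral>\<omega>. (\<integral>x. f \<omega> x \<partial>distr M borel (e N)) \<partial>M)"
      unfolding ZS[abs_def] by (rule integral_freezing[OF indep fm int])
    then show ?case using Suc by (simp add: distr_e inner)
  qed
  then show ?thesis by (simp add: Z_def[abs_def])
qed

text \<open>
  The weights \<open>X n\<close> are set to 0 from the time at which the sum of squares exceeds \<open>2 * c * r\<close>, so that
  \<open>exponential_martingale\<close> applies. The stopped quantities differ from the original ones only
  if \<open>Q / r\<close> deviates from \<open>c\<close> by more than \<open>c\<close>, so both the effect of stopping and the error from
  replacing \<open>Q / r\<close> by \<open>c\<close> in the exponent are at most a multiple of the mean deviation.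
\<close>

lemma char_transform_error:
  fixes \<theta> c r :: real and N :: nat
  assumes X: "\<And>n. X n \<in> borel_measurable (G n)" "\<And>n. integrable M (\<lambda>\<omega>. (X n \<omega>)\<^sup>2)"
    and c: "c > 0" and r: "r > 0"
  defines "S \<equiv> \<lambda>\<omega>. \<Sum>n<N. X n \<omega> * e n \<omega>" and "Q \<equiv> \<lambda>\<omega>. \<Sum>n<N. (X n \<omega>)\<^sup>2"
  shows "cmod (expectation (\<lambda>\<omega>. iexp (\<theta> * (S \<omega> / sqrt r))) - complex_of_real (exp (- (\<theta>\<^sup>2 * c / 2))))
     \<le> (2 / c * exp (\<theta>\<^sup>2 * c / 2) + \<theta>\<^sup>2 / 2 * exp (\<theta>\<^sup>2 * c)) * expectation (\<lambda>\<omega>. \<bar>Q \<omega> / r - c\<bar>)"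
proof -
  \<comment> \<open>Any level above the typical value \<open>c * r\<close> of \<open>Q\<close> would do.\<close>
  define K where "K = 2 * c * r"
  have K: "K > 0" using c r by (simp add: K_def)
  \<comment> \<open>The decision at index \<open>n\<close> involves \<open>X n\<close> itself, which is still part of the past of \<open>e n\<close>.\<close>
  define H where "H n \<omega> = (if (\<Sum>k<Suc n. (X k \<omega>)\<^sup>2) \<le> K then X n \<omega> else 0)" for n \<omega>
  define S' where "S' = (\<lambda>\<omega>. \<Sum>n<N. H n \<omega> * e n \<omega>)"
  define Q' where "Q' = (\<lambda>\<omega>. \<Sum>n<N. (H n \<omega>)\<^sup>2)"
  define t where "t = \<theta> / sqrt r"
  have XN: "X n \<in> borel_measurable (G (n + k))" for n k
    by (induction k) (auto intro: X G_measurable_Suc)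
  have XN': "X n \<in> borel_measurable (G N)" if "n \<le> N" for n N using XN[of n "N - n"] that by simp
  note [measurable] = G_measurable[OF X(1)]
  have Hm: "H n \<in> borel_measurable (G n)" for n
  proof -
    have [measurable]: "(\<lambda>\<omega>. \<Sum>k<Suc n. (X k \<omega>)\<^sup>2) \<in> borel_measurable (G n)"
      by (intro borel_measurable_sum borel_measurable_power XN') auto
    show ?thesis using X(1)[of n] unfolding H_def[abs_def] by measurable
  qed
  note [measurable] = G_measurable[OF Hm]
  have stop: "(\<Sum>n<m. (H n \<omega>)\<^sup>2) \<le> K \<and> ((\<Sum>n<m. (X n \<omega>)\<^sup>2) \<le> K \<longrightarrow> (\<forall>n<m. H n \<omega> = X n \<omega>))" for m \<omega>
  proof (induction m)
    case 0 then show ?case using K by simp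
  next
    case (Suc m)
    show ?case
    proof (cases "(\<Sum>k<Suc m. (X k \<omega>)\<^sup>2) \<le> K")
      case True
      then have "(\<Sum>k<m. (X k \<omega>)\<^sup>2) \<le> K" using zero_le_power2[of "X m \<omega>"] unfolding sum.lessThan_Suc by linarith
      with Suc have "\<forall>n<m. H n \<omega> = X n \<omega>" by simp
      moreover have "H m \<omega> = X m \<omega>" using True by (simp add: H_def)
      ultimately have eq: "\<forall>n<Suc m. H n \<omega> = X n \<omega>" by (simp add: less_Suc_eq)
      then have "(\<Sum>n<Suc m. (H n \<omega>)\<^sup>2) = (\<Sum>n<Suc m. (X n \<omega>)\<^sup>2)" by (intro sum.cong) auto
      then show ?thesis using True eq by simp
    next
      case False
      then have "H m \<omega> = 0" by (simp add: H_def)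
      then show ?thesis using False Suc by simp
    qed
  qed
  have Q'K: "Q' \<omega> \<le> K" "Q' \<omega> \<ge> 0" for \<omega> using stop[of \<omega> N] by (auto simp: Q'_def intro: sum_nonneg)
  have same: "S' \<omega> = S \<omega>" "Q' \<omega> = Q \<omega>" if "Q \<omega> \<le> K" for \<omega>
    using stop[of \<omega> N] that by (auto simp: S_def S'_def Q_def Q'_def intro: sum.cong)
  \<comment> \<open>The second term of \<open>D\<close> has expectation 1, so the expectation of \<open>D\<close> is the error to be bounded, up to the
    factor \<open>exp (\<theta>\<^sup>2 * c / 2)\<close>.\<close>
  define D where "D \<omega> = iexp (t * S \<omega>) * complex_of_real (exp (\<theta>\<^sup>2 * c / 2)) -
      iexp (t * S' \<omega>) * complex_of_real (exp (t\<^sup>2 / 2 * Q' \<omega>))" for \<omega>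
  define L where "L = 2 / c * exp (\<theta>\<^sup>2 * c / 2) + \<theta>\<^sup>2 / 2 * exp (\<theta>\<^sup>2 * c)"
  have [measurable]: "S \<in> borel_measurable M" "S' \<in> borel_measurable M" "Q \<in> borel_measurable M" "Q' \<in> borel_measurable M"
    unfolding S_def S'_def Q_def Q'_def by measurable
  have t2: "t\<^sup>2 = \<theta>\<^sup>2 / r" using r by (simp add: t_def power_divide)
  have Dbd: "cmod (D \<omega>) \<le> L * \<bar>Q \<omega> / r - c\<bar>" for \<omega>
  proof -
    let ?E = "exp (\<theta>\<^sup>2 * c / 2)" and ?F = "exp (t\<^sup>2 / 2 * Q' \<omega>)"
    have "D \<omega> = (iexp (t * S \<omega>) - iexp (t * S' \<omega>)) * complex_of_real ?E +
        iexp (t * S' \<omega>) * complex_of_real (?E - ?F)"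
      by (simp add: D_def algebra_simps)
    then have "cmod (D \<omega>) \<le> cmod (iexp (t * S \<omega>) - iexp (t * S' \<omega>)) * ?E + \<bar>?E - ?F\<bar>"
      by (metis (no_types, lifting) norm_triangle_ineq norm_mult norm_exp_i_times mult_1 norm_of_real abs_exp_cancel)
    moreover have "cmod (iexp (t * S \<omega>) - iexp (t * S' \<omega>)) \<le> 2 / c * \<bar>Q \<omega> / r - c\<bar>"
    proof (cases "Q \<omega> \<le> K")
      case False
      then have "Q \<omega> / r - c \<ge> c" using r by (simp add: K_def field_simps)
      then have "2 / c * c \<le> 2 / c * \<bar>Q \<omega> / r - c\<bar>" using c by (intro mult_left_mono) auto
      then have "2 \<le> 2 / c * \<bar>Q \<omega> / r - c\<bar>" using c by simp
      then show ?thesis using norm_iexp_diff_le_2 order_trans by blast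
    qed (use same c in simp)
    moreover have "\<bar>?E - ?F\<bar> \<le> \<theta>\<^sup>2 / 2 * exp (\<theta>\<^sup>2 * c) * \<bar>Q \<omega> / r - c\<bar>"
    proof -
      have lip: "\<bar>exp x - exp y\<bar> \<le> exp b * \<bar>x - y\<bar>" if "x \<le> b" "y \<le> b" for x y b :: real
      proof -
        have *: "exp v - exp u \<le> exp b * (v - u)" if "u \<le> v" "v \<le> b" for u v :: real
        proof -
          have "exp v - exp u = exp v * (1 - exp (u - v))" by (simp add: algebra_simps flip: exp_add)
          also have "1 - exp (u - v) \<le> v - u" using exp_ge_add_one_self[of "u - v"] by linarith
          then have "exp v * (1 - exp (u - v)) \<le> exp v * (v - u)" by (intro mult_left_mono) auto
          also have "\<dots> \<le> exp b * (v - u)" using that by (intro mult_right_mono) auto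
          finally show ?thesis .
        qed
        show ?thesis using *[of x y] *[of y x] that by (cases "x \<le> y") auto
      qed
      \<comment> \<open>If stopping takes effect, \<open>Q' / r\<close> lies between 0 and \<open>2 * c\<close> while \<open>Q / r\<close> exceeds \<open>2 * c\<close>.\<close>
      have a: "\<bar>Q' \<omega> / r - c\<bar> \<le> \<bar>Q \<omega> / r - c\<bar>"
      proof (cases "Q \<omega> \<le> K")
        case False
        then have "c \<le> Q \<omega> / r - c" using r by (simp add: K_def field_simps)
        moreover have "Q' \<omega> / r \<le> 2 * c" "0 \<le> Q' \<omega> / r" using Q'K[of \<omega>] r by (auto simp: K_def field_simps)
        ultimately show ?thesis by linarith
      qed (use same in simp)
      have "\<bar>?E - ?F\<bar> \<le> exp (\<theta>\<^sup>2 * c) * \<bar>\<theta>\<^sup>2 * c / 2 - t\<^sup>2 / 2 * Q' \<omega>\<bar>"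
      proof (rule lip)
        show "\<theta>\<^sup>2 * c / 2 \<le> \<theta>\<^sup>2 * c" using c by simp
        have "t\<^sup>2 / 2 * Q' \<omega> \<le> t\<^sup>2 / 2 * K" using Q'K[of \<omega>] by (intro mult_left_mono) auto
        also have "\<dots> = \<theta>\<^sup>2 * c" using r by (simp add: t2 K_def)
        finally show "t\<^sup>2 / 2 * Q' \<omega> \<le> \<theta>\<^sup>2 * c" .
      qed
      also have "\<bar>\<theta>\<^sup>2 * c / 2 - t\<^sup>2 / 2 * Q' \<omega>\<bar> = \<theta>\<^sup>2 / 2 * \<bar>Q' \<omega> / r - c\<bar>"
      proof -
        have "\<theta>\<^sup>2 * c / 2 - t\<^sup>2 / 2 * Q' \<omega> = (\<theta>\<^sup>2 / 2) * (c - Q' \<omega> / r)" by (simp add: t2 algebra_simps)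
        then show ?thesis by (simp only: abs_mult) (simp add: abs_minus_commute)
      qed
      also have "exp (\<theta>\<^sup>2 * c) * (\<theta>\<^sup>2 / 2 * \<bar>Q' \<omega> / r - c\<bar>) \<le> exp (\<theta>\<^sup>2 * c) * (\<theta>\<^sup>2 / 2 * \<bar>Q \<omega> / r - c\<bar>)"
        using a by (intro mult_left_mono) auto
      finally show ?thesis by (simp add: mult_ac)
    qed
    ultimately show ?thesis unfolding L_def
      by (smt (verit, best) exp_gt_zero mult_right_mono distrib_right mult.assoc mult.commute)
  qed
  have iS: "integrable M (\<lambda>\<omega>. iexp (t * S \<omega>))"
    by (rule integrable_const_bound[of _ 1]) auto
  have iS': "integrable M (\<lambda>\<omega>. iexp (t * S' \<omega>) * complex_of_real (exp (t\<^sup>2 / 2 * Q' \<omega>)))"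
    by (rule integrable_const_bound[of _ "exp (t\<^sup>2 / 2 * K)"]) (auto simp: norm_mult intro!: mult_left_mono Q'K)
  have iQ: "integrable M (\<lambda>\<omega>. \<bar>Q \<omega> / r - c\<bar>)" unfolding Q_def using X(2) by auto
  have one: "expectation (\<lambda>\<omega>. iexp (t * S' \<omega>) * complex_of_real (exp (t\<^sup>2 / 2 * Q' \<omega>))) = 1"
    unfolding S'_def Q'_def by (rule exponential_martingale[OF Hm, of K]) (use stop in blast)
  let ?I = "expectation (\<lambda>\<omega>. iexp (t * S \<omega>))"
  have "?I * complex_of_real (exp (\<theta>\<^sup>2 * c / 2)) - 1 = expectation D"
    unfolding D_def[abs_def] using iS iS' one by simp
  then have "cmod (?I * complex_of_real (exp (\<theta>\<^sup>2 * c / 2)) - 1) \<le> expectation (\<lambda>\<omega>. cmod (D \<omega>))"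
    by (simp add: integral_norm_bound)
  also have "\<dots> \<le> expectation (\<lambda>\<omega>. L * \<bar>Q \<omega> / r - c\<bar>)"
  proof (rule integral_mono)
    show "integrable M (\<lambda>\<omega>. cmod (D \<omega>))" unfolding D_def[abs_def] using iS iS' by auto
  qed (use iQ Dbd in auto)
  finally have b: "cmod (?I * complex_of_real (exp (\<theta>\<^sup>2 * c / 2)) - 1) \<le> L * expectation (\<lambda>\<omega>. \<bar>Q \<omega> / r - c\<bar>)"
    using iQ by simp
  have "?I - complex_of_real (exp (- (\<theta>\<^sup>2 * c / 2))) = (?I * complex_of_real (exp (\<theta>\<^sup>2 * c / 2)) - 1) * complex_of_real (exp (- (\<theta>\<^sup>2 * c / 2)))"
    by (simp add: algebra_simps exp_of_real exp_minus flip: exp_add of_real_mult)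
  then have "cmod (?I - complex_of_real (exp (- (\<theta>\<^sup>2 * c / 2)))) = cmod (?I * complex_of_real (exp (\<theta>\<^sup>2 * c / 2)) - 1) * exp (- (\<theta>\<^sup>2 * c / 2))"
    by (simp add: norm_mult)
  also have "\<dots> \<le> cmod (?I * complex_of_real (exp (\<theta>\<^sup>2 * c / 2)) - 1) * 1"
    using c by (intro mult_left_mono) auto
  also have "\<dots> \<le> L * expectation (\<lambda>\<omega>. \<bar>Q \<omega> / r - c\<bar>)" using b by simp
  finally show ?thesis by (simp add: t_def L_def)
qed

end

section \<open>Gaussian autoregressions with convergent coefficients\<close>

text \<open>
  A quantitative form of Slutsky's theorem. The left-hand side is at most 2, which \<open>2 / K\<^sup>2 * x\<^sup>2\<close> covers if \<open>\<bar>x\<bar>\<close> exceeds \<open>K\<close>, and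
  \<open>4 / c * \<bar>R - c\<bar>\<close> if \<open>R\<close> is below \<open>c / 2\<close>. Otherwise \<open>x / R\<close> is a Lipschitz function of \<open>R\<close>.
\<close>

lemma slutsky_quotient_bound:
  fixes x R c \<kappa> K :: real
  assumes c: "c > 0" and K: "K > 0"
  shows "cmod (iexp (\<kappa> * (x / R)) - iexp (\<kappa> * (x / c)))
     \<le> (2 * \<bar>\<kappa>\<bar> * K / c\<^sup>2 + 4 / c) * \<bar>R - c\<bar> + 2 / K\<^sup>2 * x\<^sup>2"
proof -
  have nn: "0 \<le> 2 * \<bar>\<kappa>\<bar> * K / c\<^sup>2 * \<bar>R - c\<bar>" "0 \<le> 4 / c * \<bar>R - c\<bar>" "0 \<le> 2 / K\<^sup>2 * x\<^sup>2"
    using c K by auto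
  note le2 = norm_iexp_diff_le_2[of "\<kappa> * (x / R)" "\<kappa> * (x / c)"]
  consider "R < c / 2" | "\<bar>x\<bar> > K" | "R \<ge> c / 2" "\<bar>x\<bar> \<le> K" by linarith
  then show ?thesis
  proof cases
    case 1
    then have "4 / c * (c / 2) \<le> 4 / c * \<bar>R - c\<bar>" using c by (intro mult_left_mono) auto
    then have "2 \<le> 4 / c * \<bar>R - c\<bar>" using c by simp
    then show ?thesis using nn le2 unfolding distrib_right by linarith
  next
    case 2
    then have "K\<^sup>2 \<le> x\<^sup>2" using K by (intro abs_le_square_iff[THEN iffD1]) auto
    then have "2 / K\<^sup>2 * K\<^sup>2 \<le> 2 / K\<^sup>2 * x\<^sup>2" by (intro mult_left_mono) auto
    then have "2 \<le> 2 / K\<^sup>2 * x\<^sup>2" using K by simp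
    then show ?thesis using nn le2 unfolding distrib_right by linarith
  next
    case 3
    have R: "R > 0" using 3 c by linarith
    have "cmod (iexp (\<kappa> * (x / R)) - iexp (\<kappa> * (x / c))) \<le> \<bar>\<kappa> * (x / R) - \<kappa> * (x / c)\<bar>"
      by (rule norm_iexp_diff_le)
    also have "\<kappa> * (x / R) - \<kappa> * (x / c) = \<kappa> * x * (c - R) / (R * c)"
      using R c by (simp add: field_simps)
    also have "\<bar>\<dots>\<bar> = \<bar>\<kappa>\<bar> * \<bar>x\<bar> * \<bar>R - c\<bar> / (R * c)"
      using R c by (simp add: abs_mult abs_divide abs_minus_commute)
    also have "\<dots> \<le> \<bar>\<kappa>\<bar> * K * \<bar>R - c\<bar> / (c / 2 * c)"
      using 3 R c K by (intro frac_le mult_mono mult_right_mono mult_left_mono) auto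
    also have "\<dots> = 2 * \<bar>\<kappa>\<bar> * K / c\<^sup>2 * \<bar>R - c\<bar>" using c by (simp add: power2_eq_square field_simps)
    finally show ?thesis using nn unfolding distrib_right by linarith
  qed
qed

lemma std_normal_square_centred:
  "integrable std_normal_distribution (\<lambda>x. x)" "(\<integral>x. x \<partial>std_normal_distribution) = 0"
  "integrable std_normal_distribution (\<lambda>x. x\<^sup>2)" "(\<integral>x. x\<^sup>2 \<partial>std_normal_distribution) = 1"
  "integrable std_normal_distribution (\<lambda>x. x\<^sup>2 - 1)" "(\<integral>x. x\<^sup>2 - 1 \<partial>std_normal_distribution) = 0"
  "integrable std_normal_distribution (\<lambda>x. (x\<^sup>2 - 1)\<^sup>2)" "(\<integral>x. (x\<^sup>2 - 1)\<^sup>2 \<partial>std_normal_distribution) = 2"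
proof -
  interpret N: real_distribution std_normal_distribution by (rule real_dist_normal_dist)
  note i = integrable_std_normal_distribution_moment
  show i1: "integrable std_normal_distribution (\<lambda>x. x)" using i[of 1] by simp
  show "(\<integral>x. x \<partial>std_normal_distribution) = 0" using integral_std_normal_distribution_moment_odd[of 1] by simp
  show i2: "integrable std_normal_distribution (\<lambda>x. x\<^sup>2)" by (rule i)
  show e2: "(\<integral>x. x\<^sup>2 \<partial>std_normal_distribution) = 1" using std_normal_distribution_even_moments[of 1] by simp
  have e4: "(\<integral>x. x ^ 4 \<partial>std_normal_distribution) = 3"
    using std_normal_distribution_even_moments[of 2] by (simp add: fact_numeral)
  show "integrable std_normal_distribution (\<lambda>x. x\<^sup>2 - 1)" using i2 by simp
  show "(\<integral>x. x\<^sup>2 - 1 \<partial>std_normal_distribution) = 0" using i2 e2 N.prob_space by simp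
  have sq: "(x\<^sup>2 - 1)\<^sup>2 = x ^ 4 - 2 * x\<^sup>2 + 1" for x :: real by (simp add: power2_eq_square power4_eq_xxxx algebra_simps)
  show "integrable std_normal_distribution (\<lambda>x. (x\<^sup>2 - 1)\<^sup>2)" unfolding sq using i2 i[of 4] by simp
  show "(\<integral>x. (x\<^sup>2 - 1)\<^sup>2 \<partial>std_normal_distribution) = 2" unfolding sq using i2 i[of 4] e2 e4 N.prob_space by simp
qed

locale gaussian_recursion = gaussian_noise M G e
  for M :: "'a measure" and G and e :: "nat \<Rightarrow> 'a \<Rightarrow> real" +
  fixes X :: "nat \<Rightarrow> 'a \<Rightarrow> real" and \<alpha> :: "nat \<Rightarrow> real" and \<tau> a W :: real
  assumes X_adapted: "\<And>n. X n \<in> borel_measurable (G n)"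
    and X_square_integrable: "\<And>n. integrable M (\<lambda>\<omega>. (X n \<omega>)\<^sup>2)"
    and X_second_moment: "\<And>n. expectation (\<lambda>\<omega>. (X n \<omega>)\<^sup>2) \<le> W"
    and X_Suc: "\<And>n \<omega>. X (Suc n) \<omega> = \<alpha> n * X n \<omega> + \<tau> * e n \<omega>"
    and \<alpha>_lim: "\<alpha> \<longlonglongrightarrow> a"
    and a_less_1: "\<bar>a\<bar> < 1"
    and \<tau>_pos: "\<tau> > 0"
begin

definition S :: "nat \<Rightarrow> 'a \<Rightarrow> real" where "S N \<omega> = (\<Sum>n<N. X n \<omega> * e n \<omega>)"
definition Q :: "nat \<Rightarrow> 'a \<Rightarrow> real" where "Q N \<omega> = (\<Sum>n<N. (X n \<omega>)\<^sup>2)"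
text \<open>
  The variance of the stationary autoregression with the limiting coefficient.
\<close>

definition c :: real where "c = \<tau>\<^sup>2 / (1 - a\<^sup>2)"

lemma X_measurable [measurable]: "X n \<in> borel_measurable M" by (rule G_measurable[OF X_adapted])
lemma S_measurable [measurable]: "S N \<in> borel_measurable M" unfolding S_def[abs_def] by measurable
lemma Q_measurable [measurable]: "Q N \<in> borel_measurable M" unfolding Q_def[abs_def] by measurable

lemma a2: "1 - a\<^sup>2 > 0" using a_less_1 by (simp add: abs_square_less_1)
lemma c_pos: "c > 0" using a2 \<tau>_pos by (simp add: c_def)
lemma W_nonneg: "0 \<le> W" 
  by (rule order_trans[OF _ X_second_moment[of 0]]) (simp add: integral_nonneg_AE)

text \<open>
  Fourth moments of \<open>X\<close> are avoided: \<open>X\<^sup>2\<close> enters only through the recursion for \<open>(X (Suc n))\<^sup>2\<close>, whose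
  martingale differences are \<open>A\<close> (linear in the noise) and \<open>A'\<close> (the centred squares of the noise). By orthogonality both
  have a standard deviation of order at most \<open>sqrt N\<close>.
\<close>

lemma law_of_large_numbers: "(\<lambda>N. expectation (\<lambda>\<omega>. \<bar>Q N \<omega> / real (Suc N) - c\<bar>)) \<longlonglongrightarrow> 0"
proof -
  obtain B where B: "\<And>n. \<bar>\<alpha> n\<bar> \<le> B"
    using convergent_imp_Bseq[OF convergentI[OF \<alpha>_lim]] unfolding Bseq_def by auto
  define A where "A N \<omega> = (\<Sum>n<N. (2 * \<alpha> n * \<tau> * X n \<omega>) * e n \<omega>)" for N \<omega>
  define A' where "A' N \<omega> = (\<Sum>n<N. \<tau>\<^sup>2 * ((e n \<omega>)\<^sup>2 - 1))" for N \<omega>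
  define P where "P N = sqrt (4 * B\<^sup>2 * \<tau>\<^sup>2 * W * N)" for N :: nat
  define P' where "P' N = sqrt (2 * \<tau> ^ 4 * N)" for N :: nat
  have mA[measurable]: "A N \<in> borel_measurable M" "A' N \<in> borel_measurable M" for N
    unfolding A_def[abs_def] A'_def[abs_def] by measurable
  have A: "integrable M (A N)" "expectation (\<lambda>\<omega>. \<bar>A N \<omega>\<bar>) \<le> P N" for N
  proof -
    have H: "(\<lambda>\<omega>. 2 * \<alpha> n * \<tau> * X n \<omega>) \<in> borel_measurable (G n)" for n using X_adapted[of n] by measurable
    have H2: "integrable M (\<lambda>\<omega>. (2 * \<alpha> n * \<tau> * X n \<omega>)\<^sup>2)" for n
      using X_square_integrable[of n] by (simp add: power_mult_distrib)
    note T = transform_second_moment[of "\<lambda>n \<omega>. 2 * \<alpha> n * \<tau> * X n \<omega>" "\<lambda>x. x" N, OF H H2 std_normal_square_centred(1-3)]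
    have i: "integrable M (\<lambda>\<omega>. (A N \<omega>)\<^sup>2)" using T(2) by (simp add: A_def)
    have "expectation (\<lambda>\<omega>. (A N \<omega>)\<^sup>2) = (\<Sum>n<N. expectation (\<lambda>\<omega>. (2 * \<alpha> n * \<tau> * X n \<omega>)\<^sup>2))"
      using T(3) by (simp add: A_def std_normal_square_centred)
    also have "\<dots> = (\<Sum>n<N. 4 * (\<alpha> n)\<^sup>2 * \<tau>\<^sup>2 * expectation (\<lambda>\<omega>. (X n \<omega>)\<^sup>2))"
      by (simp add: power_mult_distrib)
    also have "\<dots> \<le> (\<Sum>n<N. 4 * B\<^sup>2 * \<tau>\<^sup>2 * W)"
    proof (intro sum_mono mult_mono X_second_moment)
      show "(\<alpha> n)\<^sup>2 \<le> B\<^sup>2" for n using power_mono[OF B[of n] abs_ge_zero, of 2] by simp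
    qed (auto intro!: integral_nonneg_AE)
    also have "\<dots> = 4 * B\<^sup>2 * \<tau>\<^sup>2 * W * N" by simp
    finally have "sqrt (expectation (\<lambda>\<omega>. (A N \<omega>)\<^sup>2)) \<le> P N" unfolding P_def by (rule real_sqrt_le_mono)
    then show "integrable M (A N)" "expectation (\<lambda>\<omega>. \<bar>A N \<omega>\<bar>) \<le> P N"
      using abs_mean_le_sqrt_second_moment[OF mA(1) i] by auto
  qed
  have A': "integrable M (A' N)" "expectation (\<lambda>\<omega>. \<bar>A' N \<omega>\<bar>) \<le> P' N" for N
  proof -
    have H: "(\<lambda>\<omega>. \<tau>\<^sup>2) \<in> borel_measurable (G n)" for n by measurable
    have H2: "integrable M (\<lambda>\<omega>. (\<tau>\<^sup>2)\<^sup>2)" by simp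
    note T = transform_second_moment[of "\<lambda>n \<omega>. \<tau>\<^sup>2" "\<lambda>x. x\<^sup>2 - 1" N, OF H H2 std_normal_square_centred(5-7)]
    have i: "integrable M (\<lambda>\<omega>. (A' N \<omega>)\<^sup>2)" using T(2) by (simp add: A'_def)
    have "expectation (\<lambda>\<omega>. (A' N \<omega>)\<^sup>2) = 2 * \<tau> ^ 4 * N"
      using T(3) by (simp add: A'_def std_normal_square_centred prob_space)
    then show "integrable M (A' N)" "expectation (\<lambda>\<omega>. \<bar>A' N \<omega>\<bar>) \<le> P' N"
      using abs_mean_le_sqrt_second_moment[OF mA(2) i] by (auto simp: P'_def)
  qed
  have step: "(X (Suc n) \<omega>)\<^sup>2 = (\<alpha> n)\<^sup>2 * (X n \<omega>)\<^sup>2 + (2 * \<alpha> n * \<tau> * X n \<omega>) * e n \<omega> + \<tau>\<^sup>2 * ((e n \<omega>)\<^sup>2 - 1) + \<tau>\<^sup>2" for n \<omega>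
    unfolding X_Suc by (simp add: power2_eq_square algebra_simps)
  have decomp: "(1 - a\<^sup>2) * Q N \<omega> = (X 0 \<omega>)\<^sup>2 - (X N \<omega>)\<^sup>2 + (\<Sum>n<N. ((\<alpha> n)\<^sup>2 - a\<^sup>2) * (X n \<omega>)\<^sup>2) +
      A N \<omega> + A' N \<omega> + N * \<tau>\<^sup>2" for N \<omega>
  proof (induction N)
    case 0 then show ?case by (simp add: Q_def A_def A'_def)
  next
    case (Suc N)
    have "(1 - a\<^sup>2) * Q (Suc N) \<omega> = (1 - a\<^sup>2) * Q N \<omega> + ((X N \<omega>)\<^sup>2 - a\<^sup>2 * (X N \<omega>)\<^sup>2)"
      by (simp add: Q_def algebra_simps)
    moreover have "A (Suc N) \<omega> = A N \<omega> + (2 * \<alpha> N * \<tau> * X N \<omega>) * e N \<omega>"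
      "A' (Suc N) \<omega> = A' N \<omega> + \<tau>\<^sup>2 * ((e N \<omega>)\<^sup>2 - 1)"
      "real (Suc N) * \<tau>\<^sup>2 = real N * \<tau>\<^sup>2 + \<tau>\<^sup>2"
      "((\<alpha> N)\<^sup>2 - a\<^sup>2) * (X N \<omega>)\<^sup>2 = (\<alpha> N)\<^sup>2 * (X N \<omega>)\<^sup>2 - a\<^sup>2 * (X N \<omega>)\<^sup>2"
      by (simp_all add: A_def A'_def algebra_simps)
    ultimately show ?case using Suc step[of N \<omega>] unfolding sum.lessThan_Suc by linarith
  qed
  define U where "U N = (2 * W + W * (\<Sum>n<N. \<bar>(\<alpha> n)\<^sup>2 - a\<^sup>2\<bar>) + P N + P' N + \<tau>\<^sup>2) / ((1 - a\<^sup>2) * real (Suc N))" for N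
  have bound: "expectation (\<lambda>\<omega>. \<bar>Q N \<omega> / real (Suc N) - c\<bar>) \<le> U N" for N
  proof -
    let ?k = "(1 - a\<^sup>2) * real (Suc N)"
    let ?B = "\<lambda>\<omega>. (X 0 \<omega>)\<^sup>2 + (X N \<omega>)\<^sup>2 + (\<Sum>n<N. \<bar>(\<alpha> n)\<^sup>2 - a\<^sup>2\<bar> * (X n \<omega>)\<^sup>2) + \<bar>A N \<omega>\<bar> + \<bar>A' N \<omega>\<bar> + \<tau>\<^sup>2"
    have k: "?k > 0" using a2 by simp
    have pt: "\<bar>Q N \<omega> / real (Suc N) - c\<bar> \<le> ?B \<omega> / ?k" for \<omega>
    proof -
      have "Q N \<omega> / real (Suc N) - c = ((1 - a\<^sup>2) * Q N \<omega> - real (Suc N) * \<tau>\<^sup>2) / ?k"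
        using a2 by (simp add: c_def field_simps del: of_nat_Suc)
      also have "(1 - a\<^sup>2) * Q N \<omega> - real (Suc N) * \<tau>\<^sup>2 = (X 0 \<omega>)\<^sup>2 - (X N \<omega>)\<^sup>2 +
          (\<Sum>n<N. ((\<alpha> n)\<^sup>2 - a\<^sup>2) * (X n \<omega>)\<^sup>2) + A N \<omega> + A' N \<omega> - \<tau>\<^sup>2" (is "_ = ?R")
        unfolding decomp by (simp add: algebra_simps)
      finally have "\<bar>Q N \<omega> / real (Suc N) - c\<bar> = \<bar>?R\<bar> / ?k" using k by (simp only: abs_divide abs_of_pos)
      also have "\<dots> \<le> ?B \<omega> / ?k"
      proof (rule divide_right_mono)
        have "\<bar>\<Sum>n<N. ((\<alpha> n)\<^sup>2 - a\<^sup>2) * (X n \<omega>)\<^sup>2\<bar> \<le> (\<Sum>n<N. \<bar>(\<alpha> n)\<^sup>2 - a\<^sup>2\<bar> * (X n \<omega>)\<^sup>2)"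
          by (rule order_trans[OF sum_abs]) (simp add: abs_mult)
        then show "\<bar>?R\<bar> \<le> ?B \<omega>"
          using zero_le_power2[of "X 0 \<omega>"] zero_le_power2[of "X N \<omega>"] zero_le_power2[of \<tau>] by linarith
      qed (use k in simp)
      finally show ?thesis .
    qed
    note int = X_square_integrable A(1) A'(1)
    have "expectation (\<lambda>\<omega>. \<bar>Q N \<omega> / real (Suc N) - c\<bar>) \<le> expectation (\<lambda>\<omega>. ?B \<omega> / ?k)"
      using int pt by (intro integral_mono) (auto simp: Q_def)
    also have "\<dots> = expectation ?B / ?k" by simp
    also have "expectation ?B = expectation (\<lambda>\<omega>. (X 0 \<omega>)\<^sup>2) + expectation (\<lambda>\<omega>. (X N \<omega>)\<^sup>2) +
        (\<Sum>n<N. \<bar>(\<alpha> n)\<^sup>2 - a\<^sup>2\<bar> * expectation (\<lambda>\<omega>. (X n \<omega>)\<^sup>2)) + expectation (\<lambda>\<omega>. \<bar>A N \<omega>\<bar>) +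
        expectation (\<lambda>\<omega>. \<bar>A' N \<omega>\<bar>) + \<tau>\<^sup>2"
      using int by (simp add: prob_space)
    also have "\<dots> \<le> W + W + (\<Sum>n<N. \<bar>(\<alpha> n)\<^sup>2 - a\<^sup>2\<bar> * W) + P N + P' N + \<tau>\<^sup>2"
      by (intro add_mono sum_mono mult_left_mono X_second_moment A A') auto
    finally show ?thesis using k unfolding U_def by (simp add: divide_right_mono sum_distrib_left mult_ac)
  qed
  have "U \<longlonglongrightarrow> 0"
  proof -
    have inv: "(\<lambda>N. x / real (Suc N)) \<longlonglongrightarrow> 0" for x
      using tendsto_mult_right_zero[OF LIMSEQ_inverse_real_of_nat, of x] by (simp add: field_simps)
    have root: "(\<lambda>N. sqrt (x * real N) / real (Suc N)) \<longlonglongrightarrow> 0" if "x \<ge> 0" for x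
    proof (rule tendsto_sandwich[OF _ _ tendsto_const])
      show "(\<lambda>N. sqrt (x / real (Suc N))) \<longlonglongrightarrow> 0"
        using tendsto_real_sqrt[OF inv[of x]] by simp
      show "\<forall>\<^sub>F N in sequentially. sqrt (x * real N) / real (Suc N) \<le> sqrt (x / real (Suc N))"
      proof (intro always_eventually allI)
        fix N
        have "sqrt (x * real N) / real (Suc N) \<le> sqrt (x * real (Suc N)) / real (Suc N)"
          using that by (intro divide_right_mono real_sqrt_le_mono mult_left_mono) auto
        also have "\<dots> = sqrt (x / real (Suc N))"
          by (simp add: real_sqrt_mult real_sqrt_divide real_div_sqrt field_simps del: of_nat_Suc)
        finally show "sqrt (x * real N) / real (Suc N) \<le> sqrt (x / real (Suc N))" .
      qed
    qed (use that in \<open>auto intro!: always_eventually\<close>)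
    have "(\<lambda>n. \<bar>(\<alpha> n)\<^sup>2 - a\<^sup>2\<bar>) \<longlonglongrightarrow> \<bar>a\<^sup>2 - a\<^sup>2\<bar>" by (intro tendsto_intros \<alpha>_lim)
    then have ces: "(\<lambda>N. (\<Sum>n<N. \<bar>(\<alpha> n)\<^sup>2 - a\<^sup>2\<bar>) / real (Suc N)) \<longlonglongrightarrow> 0" by (intro Cesaro_zero) simp
    have "(\<lambda>N. (2 * W / real (Suc N) + W * ((\<Sum>n<N. \<bar>(\<alpha> n)\<^sup>2 - a\<^sup>2\<bar>) / real (Suc N)) + P N / real (Suc N) +
        P' N / real (Suc N) + \<tau>\<^sup>2 / real (Suc N)) / (1 - a\<^sup>2)) \<longlonglongrightarrow> (0 + W * 0 + 0 + 0 + 0) / (1 - a\<^sup>2)"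
      unfolding P_def P'_def by (intro tendsto_intros inv root ces) (use a2 W_nonneg in auto)
    moreover have "U = (\<lambda>N. (2 * W / real (Suc N) + W * ((\<Sum>n<N. \<bar>(\<alpha> n)\<^sup>2 - a\<^sup>2\<bar>) / real (Suc N)) + P N / real (Suc N) +
        P' N / real (Suc N) + \<tau>\<^sup>2 / real (Suc N)) / (1 - a\<^sup>2))"
      unfolding U_def by (simp add: fun_eq_iff add_divide_distrib mult.commute del: of_nat_Suc)
    ultimately show ?thesis by (simp del: of_nat_Suc)
  qed
  then show ?thesis
    by (rule tendsto_sandwich[OF _ _ tendsto_const, rotated 2])
       (use bound in \<open>auto intro!: always_eventually integral_nonneg_AE\<close>)
qed

end

context gaussian_recursion
begin

text \<open>
  The constant \<open>K\<close> of \<open>slutsky_quotient_bound\<close> is fixed first, large enough for \<open>2 / K\<^sup>2 * W\<close> to be small; the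
  remaining error is a constant times the mean deviation \<open>\<delta>\<close>, which tends to 0.
\<close>

theorem char_normalized_error:
  "(\<lambda>N. char (distr M borel (\<lambda>\<omega>. sqrt (real (Suc N)) * (\<tau> * S N \<omega> / Q N \<omega>))) u)
     \<longlonglongrightarrow> complex_of_real (exp (- (u\<^sup>2 * (1 - a\<^sup>2) / 2)))"
proof (rule LIMSEQ_I)
  fix \<epsilon> :: real assume \<epsilon>: "\<epsilon> > 0"
  define \<kappa> where "\<kappa> = u * \<tau>"
  define \<theta> where "\<theta> = \<kappa> / c"
  define \<delta> where "\<delta> N = expectation (\<lambda>\<omega>. \<bar>Q N \<omega> / real (Suc N) - c\<bar>)" for N
  \<comment> \<open>Adding 1 to \<open>W\<close> keeps \<open>K\<close> positive if \<open>W = 0\<close>.\<close>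
  define K where "K = sqrt (4 * (W + 1) / \<epsilon>)"
  have K: "K > 0" "2 / K\<^sup>2 * W < \<epsilon>"
    using \<epsilon> W_nonneg by (auto simp: K_def field_simps intro!: add_pos_nonneg)
  define L where "L = 2 * \<bar>\<kappa>\<bar> * K / c\<^sup>2 + 4 / c + (2 / c * exp (\<theta>\<^sup>2 * c / 2) + \<theta>\<^sup>2 / 2 * exp (\<theta>\<^sup>2 * c))"
  have err: "cmod (char (distr M borel (\<lambda>\<omega>. sqrt (real (Suc N)) * (\<tau> * S N \<omega> / Q N \<omega>))) u -
      complex_of_real (exp (- (u\<^sup>2 * (1 - a\<^sup>2) / 2)))) \<le> L * \<delta> N + 2 / K\<^sup>2 * W" for N
  proof -
    define r where "r = real (Suc N)"
    have r: "r > 0" by (simp add: r_def)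
    define x where "x \<omega> = S N \<omega> / sqrt r" for \<omega>
    define R where "R \<omega> = Q N \<omega> / r" for \<omega>
    have [measurable]: "x \<in> borel_measurable M" "R \<in> borel_measurable M"
      unfolding x_def[abs_def] R_def[abs_def] by measurable
    have eq: "u * (sqrt r * (\<tau> * S N \<omega> / Q N \<omega>)) = \<kappa> * (x \<omega> / R \<omega>)" for \<omega>
      using r real_sqrt_mult_self[of r] by (cases "Q N \<omega> = 0") (simp_all add: \<kappa>_def x_def R_def field_simps)
    have ch: "char (distr M borel (\<lambda>\<omega>. sqrt r * (\<tau> * S N \<omega> / Q N \<omega>))) u = expectation (\<lambda>\<omega>. iexp (\<kappa> * (x \<omega> / R \<omega>)))"
      unfolding char_def eq[symmetric] by (subst integral_distr) auto
    have lim: "\<theta>\<^sup>2 * c / 2 = u\<^sup>2 * (1 - a\<^sup>2) / 2"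
      using c_pos \<tau>_pos a2 by (simp add: \<theta>_def \<kappa>_def c_def power2_eq_square field_simps)
    have i: "integrable M (\<lambda>\<omega>. iexp (\<kappa> * (x \<omega> / R \<omega>)))" "integrable M (\<lambda>\<omega>. iexp (\<kappa> * (x \<omega> / c)))"
      by (rule integrable_const_bound[of _ 1]; simp)+
    have iR: "integrable M (\<lambda>\<omega>. \<bar>R \<omega> - c\<bar>)" unfolding R_def Q_def using X_square_integrable by auto
    note T = transform_second_moment[of X "\<lambda>x. x" N, OF X_adapted X_square_integrable std_normal_square_centred(1-3)]
    have ix: "integrable M (\<lambda>\<omega>. (x \<omega>)\<^sup>2)" unfolding x_def S_def power_divide using T(2) by simp
    have "expectation (\<lambda>\<omega>. (S N \<omega>)\<^sup>2) = (\<Sum>n<N. expectation (\<lambda>\<omega>. (X n \<omega>)\<^sup>2))"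
      using T(3) by (simp add: S_def std_normal_square_centred)
    also have "\<dots> \<le> (\<Sum>n<N. W)" by (intro sum_mono X_second_moment)
    also have "\<dots> \<le> r * W" using W_nonneg by (simp add: r_def mult_right_mono)
    finally have ex: "expectation (\<lambda>\<omega>. (x \<omega>)\<^sup>2) \<le> W"
      unfolding x_def power_divide using r by (simp add: field_simps)
    have "cmod (expectation (\<lambda>\<omega>. iexp (\<kappa> * (x \<omega> / R \<omega>))) - expectation (\<lambda>\<omega>. iexp (\<kappa> * (x \<omega> / c)))) \<le>
        expectation (\<lambda>\<omega>. cmod (iexp (\<kappa> * (x \<omega> / R \<omega>)) - iexp (\<kappa> * (x \<omega> / c))))"
      unfolding Bochner_Integration.integral_diff[OF i, symmetric] by (rule integral_norm_bound)
    also have "\<dots> \<le> expectation (\<lambda>\<omega>. (2 * \<bar>\<kappa>\<bar> * K / c\<^sup>2 + 4 / c) * \<bar>R \<omega> - c\<bar> + 2 / K\<^sup>2 * (x \<omega>)\<^sup>2)"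
    proof (rule integral_mono)
      show "integrable M (\<lambda>\<omega>. cmod (iexp (\<kappa> * (x \<omega> / R \<omega>)) - iexp (\<kappa> * (x \<omega> / c))))" using i by auto
      show "integrable M (\<lambda>\<omega>. (2 * \<bar>\<kappa>\<bar> * K / c\<^sup>2 + 4 / c) * \<bar>R \<omega> - c\<bar> + 2 / K\<^sup>2 * (x \<omega>)\<^sup>2)"
        by (intro Bochner_Integration.integrable_add integrable_mult_right iR ix)
    qed (rule slutsky_quotient_bound[OF c_pos K(1)])
    also have "\<dots> = (2 * \<bar>\<kappa>\<bar> * K / c\<^sup>2 + 4 / c) * \<delta> N + 2 / K\<^sup>2 * expectation (\<lambda>\<omega>. (x \<omega>)\<^sup>2)"
    proof -
      have "expectation (\<lambda>\<omega>. p * \<bar>R \<omega> - c\<bar> + q * (x \<omega>)\<^sup>2) = p * expectation (\<lambda>\<omega>. \<bar>R \<omega> - c\<bar>) + q * expectation (\<lambda>\<omega>. (x \<omega>)\<^sup>2)" for p q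
        using iR ix by simp
      from this[of "2 * \<bar>\<kappa>\<bar> * K / c\<^sup>2 + 4 / c" "2 / K\<^sup>2"] show ?thesis unfolding \<delta>_def R_def r_def .
    qed
    also have "\<dots> \<le> (2 * \<bar>\<kappa>\<bar> * K / c\<^sup>2 + 4 / c) * \<delta> N + 2 / K\<^sup>2 * W"
      using ex by (intro add_left_mono mult_left_mono) auto
    finally have 1: "cmod (expectation (\<lambda>\<omega>. iexp (\<kappa> * (x \<omega> / R \<omega>))) - expectation (\<lambda>\<omega>. iexp (\<kappa> * (x \<omega> / c)))) \<le>
        (2 * \<bar>\<kappa>\<bar> * K / c\<^sup>2 + 4 / c) * \<delta> N + 2 / K\<^sup>2 * W" .
    have "\<kappa> * (x \<omega> / c) = \<theta> * (S N \<omega> / sqrt r)" for \<omega> by (simp add: \<theta>_def x_def)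
    then have 2: "cmod (expectation (\<lambda>\<omega>. iexp (\<kappa> * (x \<omega> / c))) - complex_of_real (exp (- (\<theta>\<^sup>2 * c / 2)))) \<le>
        (2 / c * exp (\<theta>\<^sup>2 * c / 2) + \<theta>\<^sup>2 / 2 * exp (\<theta>\<^sup>2 * c)) * \<delta> N"
      using char_transform_error[of X c r \<theta> N, OF X_adapted X_square_integrable c_pos r]
      unfolding \<delta>_def S_def Q_def r_def by simp
    have "cmod (expectation (\<lambda>\<omega>. iexp (\<kappa> * (x \<omega> / R \<omega>))) - complex_of_real (exp (- (\<theta>\<^sup>2 * c / 2)))) \<le>
        ((2 * \<bar>\<kappa>\<bar> * K / c\<^sup>2 + 4 / c) * \<delta> N + 2 / K\<^sup>2 * W) +
        (2 / c * exp (\<theta>\<^sup>2 * c / 2) + \<theta>\<^sup>2 / 2 * exp (\<theta>\<^sup>2 * c)) * \<delta> N"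
      by (rule norm_diff_triangle_le[OF 1 2])
    also have "\<dots> = L * \<delta> N + 2 / K\<^sup>2 * W" by (simp add: L_def algebra_simps)
    finally show ?thesis unfolding lim ch[symmetric] unfolding r_def .
  qed
  have "(\<lambda>N. L * \<delta> N + 2 / K\<^sup>2 * W) \<longlonglongrightarrow> L * 0 + 2 / K\<^sup>2 * W"
    using law_of_large_numbers unfolding \<delta>_def by (intro tendsto_intros)
  then have "\<forall>\<^sub>F N in sequentially. L * \<delta> N + 2 / K\<^sup>2 * W < \<epsilon>"
    by (rule order_tendstoD) (use K in simp)
  then obtain n where "\<And>N. N \<ge> n \<Longrightarrow> L * \<delta> N + 2 / K\<^sup>2 * W < \<epsilon>"
    by (auto simp: eventually_sequentially)
  then show "\<exists>n. \<forall>N\<ge>n. norm (char (distr M borel (\<lambda>\<omega>. sqrt (real (Suc N)) * (\<tau> * S N \<omega> / Q N \<omega>))) u -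
      complex_of_real (exp (- (u\<^sup>2 * (1 - a\<^sup>2) / 2)))) < \<epsilon>"
    using err by (meson order_le_less_trans)
qed

end

section \<open>The gaussian copula with normal margins\<close>

lemma cdf_std_normal_strict_mono:
  assumes "x < y" shows "cdf std_normal_distribution x < cdf std_normal_distribution y"
proof -
  interpret N: real_distribution std_normal_distribution by (rule real_dist_normal_dist)
  have pos: "\<not> std_normal_density z \<le> 0" for z
    using normal_density_pos[of 1 0 z] by simp
  have "emeasure std_normal_distribution {x<..y} \<noteq> 0"
  proof
    assume "emeasure std_normal_distribution {x<..y} = 0"
    then have "(\<integral>\<^sup>+z. ennreal (std_normal_density z) * indicator {x<..y} z \<partial>lborel) = 0"
      by (simp add: emeasure_density)
    then have "AE z in lborel. ennreal (std_normal_density z) * indicator {x<..y} z = 0"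
      by (subst (asm) nn_integral_0_iff_AE) auto
    then have "AE z in lborel. z \<notin> {x<..y}"
      by eventually_elim (auto simp: indicator_def ennreal_eq_0_iff pos split: if_splits)
    then have "emeasure lborel {x<..y} = 0" by (subst (asm) AE_iff_measurable[of "{x<..y}"]) auto
    with assms show False by simp
  qed
  then have "measure std_normal_distribution {x<..y} > 0"
    by (simp add: N.emeasure_eq_measure zero_less_measure_iff)
  then show ?thesis using N.cdf_diff_eq[OF assms] by simp
qed

lemma gaussian_copula_at_normal_margins:
  "gaussian_copula \<rho> (cdf std_normal_distribution x) (cdf std_normal_distribution y) = binormal_cdf \<rho> x y"
proof -
  interpret N: real_distribution std_normal_distribution by (rule real_dist_normal_dist)
  have inj: "inj (cdf std_normal_distribution)"
    by (rule linorder_injI) (use cdf_std_normal_strict_mono in \<open>force dest: less_imp_neq\<close>)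
  have "0 < cdf std_normal_distribution z" "cdf std_normal_distribution z < 1" for z
    using cdf_std_normal_strict_mono[of "z - 1" z] cdf_std_normal_strict_mono[of z "z + 1"]
      N.cdf_nonneg[of "z - 1"] N.cdf_bounded_prob[of "z + 1"] by linarith+
  from this[of x] this[of y] show ?thesis
    by (simp add: gaussian_copula_def inv_f_f[OF inj])
qed

text \<open>
  The linear map that turns two independent standard normal variables into a pair with correlation \<open>\<rho>\<close>.
\<close>

definition correlate :: "real \<Rightarrow> real \<times> real \<Rightarrow> real \<times> real" where
  "correlate \<rho> = (\<lambda>(z, w). (sqrt (1 - \<rho>\<^sup>2) * z + \<rho> * w, w))"

lemma correlate_measurable [measurable]: "correlate \<rho> \<in> borel \<Otimes>\<^sub>M borel \<rightarrow>\<^sub>M borel \<Otimes>\<^sub>M borel"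
  unfolding correlate_def by measurable

lemma binormal_density_factor:
  assumes "\<bar>\<rho>\<bar> < 1"
  shows "binormal_density \<rho> (x, y) = std_normal_density y * normal_density (\<rho> * y) (sqrt (1 - \<rho>\<^sup>2)) x"
proof -
  have s: "1 - \<rho>\<^sup>2 > 0" using assms by (simp add: abs_square_less_1)
  have "- (x\<^sup>2 - 2 * \<rho> * x * y + y\<^sup>2) / (2 * (1 - \<rho>\<^sup>2)) = - y\<^sup>2 / 2 + - (x - \<rho> * y)\<^sup>2 / (2 * (1 - \<rho>\<^sup>2))"
    using s by (simp add: field_simps power2_eq_square)
  then have e: "exp (- (x\<^sup>2 - 2 * \<rho> * x * y + y\<^sup>2) / (2 * (1 - \<rho>\<^sup>2))) =
      exp (- y\<^sup>2 / 2) * exp (- (x - \<rho> * y)\<^sup>2 / (2 * (1 - \<rho>\<^sup>2)))"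
    by (simp only: exp_add)
  have "sqrt (2 * pi) * sqrt (2 * pi * (1 - \<rho>\<^sup>2)) = (sqrt (2 * pi) * sqrt (2 * pi)) * sqrt (1 - \<rho>\<^sup>2)"
    by (subst real_sqrt_mult[of "2 * pi"]) (rule mult.assoc[symmetric])
  then have r: "2 * pi * sqrt (1 - \<rho>\<^sup>2) = sqrt (2 * pi) * sqrt (2 * pi * (1 - \<rho>\<^sup>2))"
    by simp
  show ?thesis
    unfolding binormal_density_def prod.case e r normal_density_def using s by simp
qed

text \<open>
  The binormal density is the density of the second coordinate times the conditional density of the first one
  (\<open>binormal_density_factor\<close>), and for fixed second coordinate the map \<open>correlate\<close> is an affine substitution.
\<close>

lemma binormal_cdf_eq_correlate:
  assumes "\<bar>\<rho>\<bar> < 1"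
  shows "binormal_cdf \<rho> x y =
     measure (distr (std_normal_distribution \<Otimes>\<^sub>M std_normal_distribution) (borel \<Otimes>\<^sub>M borel) (correlate \<rho>)) ({..x} \<times> {..y})"
proof -
  let ?N = "std_normal_distribution" and ?s = "sqrt (1 - \<rho>\<^sup>2)"
  have s: "?s > 0" using assms by (simp add: abs_square_less_1)
  interpret N: real_distribution ?N by (rule real_dist_normal_dist)
  interpret P: pair_prob_space ?N ?N ..
  have [measurable]: "binormal_density \<rho> \<in> borel_measurable (borel \<Otimes>\<^sub>M borel)"
    unfolding binormal_density_def by measurable
  have inner: "(\<integral>\<^sup>+u. ennreal (normal_density (\<rho> * w) ?s u) * indicator {..x} u \<partial>lborel) =
      (\<integral>\<^sup>+z. ennreal (std_normal_density z) * indicator {..x} (?s * z + \<rho> * w) \<partial>lborel)" for w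
  proof -
    have "(\<integral>\<^sup>+u. ennreal (normal_density (\<rho> * w) ?s u) * indicator {..x} u \<partial>lborel) =
        \<bar>?s\<bar> * (\<integral>\<^sup>+z. ennreal (normal_density (\<rho> * w) ?s (\<rho> * w + ?s * z)) * indicator {..x} (\<rho> * w + ?s * z) \<partial>lborel)"
      using s by (intro nn_integral_real_affine) auto
    also have "\<dots> = (\<integral>\<^sup>+z. ennreal ?s * (ennreal (normal_density (\<rho> * w) ?s (\<rho> * w + ?s * z)) * indicator {..x} (\<rho> * w + ?s * z)) \<partial>lborel)"
      using s by (subst nn_integral_cmult) auto
    also have "\<dots> = (\<integral>\<^sup>+z. ennreal (std_normal_density z) * indicator {..x} (?s * z + \<rho> * w) \<partial>lborel)"
    proof (rule nn_integral_cong)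
      fix z
      have "?s * normal_density (\<rho> * w) ?s (\<rho> * w + ?s * z) = std_normal_density z"
        using s by (simp add: normal_density_def real_sqrt_mult power_mult_distrib) (simp add: field_simps)
      then show "ennreal ?s * (ennreal (normal_density (\<rho> * w) ?s (\<rho> * w + ?s * z)) * indicator {..x} (\<rho> * w + ?s * z)) =
          ennreal (std_normal_density z) * indicator {..x} (?s * z + \<rho> * w)"
        using s by (simp add: add.commute flip: ennreal_mult' mult.assoc)
    qed
    finally show ?thesis .
  qed
  have "emeasure (density (lborel \<Otimes>\<^sub>M lborel) (\<lambda>z. ennreal (binormal_density \<rho> z))) ({..x} \<times> {..y}) =
      (\<integral>\<^sup>+z. ennreal (binormal_density \<rho> z) * indicator ({..x} \<times> {..y}) z \<partial>(lborel \<Otimes>\<^sub>M lborel))"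
    by (intro emeasure_density) measurable
  also have "\<dots> = (\<integral>\<^sup>+w. \<integral>\<^sup>+u. ennreal (binormal_density \<rho> (u, w)) * indicator ({..x} \<times> {..y}) (u, w) \<partial>lborel \<partial>lborel)"
    by (intro lborel_pair.nn_integral_snd[symmetric]) measurable
  also have "\<dots> = (\<integral>\<^sup>+w. (ennreal (std_normal_density w) * indicator {..y} w) *
      (\<integral>\<^sup>+u. ennreal (normal_density (\<rho> * w) ?s u) * indicator {..x} u \<partial>lborel) \<partial>lborel)"
    by (subst nn_integral_cmult[symmetric])
       (auto intro!: nn_integral_cong simp: binormal_density_factor[OF assms] ennreal_mult indicator_times mult_ac)
  also have "\<dots> = (\<integral>\<^sup>+w. ennreal (std_normal_density w) * (\<integral>\<^sup>+z. indicator {..x} (?s * z + \<rho> * w) * indicator {..y} w \<partial>?N) \<partial>lborel)"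
    unfolding inner
    by (subst nn_integral_density) (auto simp: nn_integral_multc mult_ac simp flip: nn_integral_cmult intro!: nn_integral_cong)
  also have "\<dots> = (\<integral>\<^sup>+w. \<integral>\<^sup>+z. indicator {..x} (?s * z + \<rho> * w) * indicator {..y} w \<partial>?N \<partial>?N)"
    by (subst (2) nn_integral_density) auto
  also have "\<dots> = (\<integral>\<^sup>+v. indicator {..x} (?s * fst v + \<rho> * snd v) * indicator {..y} (snd v) \<partial>(?N \<Otimes>\<^sub>M ?N))"
    by (subst P.nn_integral_snd[symmetric]) auto
  also have "\<dots> = (\<integral>\<^sup>+v. indicator ({..x} \<times> {..y}) (correlate \<rho> v) \<partial>(?N \<Otimes>\<^sub>M ?N))"
    by (intro nn_integral_cong) (auto simp: correlate_def indicator_def split: prod.splits)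
  also have "\<dots> = emeasure (distr (?N \<Otimes>\<^sub>M ?N) (borel \<Otimes>\<^sub>M borel) (correlate \<rho>)) ({..x} \<times> {..y})"
  proof -
    have cm: "correlate \<rho> \<in> ?N \<Otimes>\<^sub>M ?N \<rightarrow>\<^sub>M borel \<Otimes>\<^sub>M borel"
      using correlate_measurable by (simp cong: measurable_cong_sets sets_pair_measure_cong)
    have "(\<integral>\<^sup>+v. indicator ({..x} \<times> {..y}) (correlate \<rho> v) \<partial>(?N \<Otimes>\<^sub>M ?N)) =
        (\<integral>\<^sup>+v. indicator ({..x} \<times> {..y}) v \<partial>distr (?N \<Otimes>\<^sub>M ?N) (borel \<Otimes>\<^sub>M borel) (correlate \<rho>))"
      by (rule nn_integral_distr[OF cm, symmetric]) measurable
    then show ?thesis by simp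
  qed
  finally show ?thesis unfolding binormal_cdf_def measure_def by simp
qed

lemma real_pair_measure_eqI_quadrants:
  fixes M N :: "(real \<times> real) measure"
  assumes "finite_measure M" "sets M = sets (borel \<Otimes>\<^sub>M borel)" "sets N = sets (borel \<Otimes>\<^sub>M borel)"
    and eq: "\<And>x y. emeasure M ({..x} \<times> {..y}) = emeasure N ({..x} \<times> {..y})"
  shows "M = N"
proof (rule measure_eqI_generator_eq)
  let ?E = "range (\<lambda>a. {..a :: real \<times> real})"
  show "Int_stable ?E" 
  proof (rule Int_stableI)
    fix A B assume "A \<in> ?E" "B \<in> ?E"
    then obtain a b where "A = {..a}" "B = {..b}" by auto
    then have "A \<inter> B = {..(min (fst a) (fst b), min (snd a) (snd b))}" by (auto simp: less_eq_prod_def)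
    then show "A \<inter> B \<in> ?E" by blast
  qed
  show "?E \<subseteq> Pow UNIV" by auto
  have q: "{..a} = {..fst a} \<times> {..snd a}" for a :: "real \<times> real" by (auto simp: less_eq_prod_def)
  show "emeasure M A = emeasure N A" if "A \<in> ?E" for A using that eq by (auto simp: q)
  have "sets (borel :: (real \<times> real) measure) = sigma_sets UNIV ?E"
    by (subst borel_eq_atMost) simp
  then show "sets M = sigma_sets UNIV ?E" "sets N = sigma_sets UNIV ?E"
    unfolding assms(2,3) borel_prod by simp_all
  let ?A = "\<lambda>i::nat. {..(real i, real i)}"
  show "range ?A \<subseteq> ?E" by auto
  show "(\<Union>i. ?A i) = UNIV"
  proof (intro set_eqI iffI UNIV_I)
    fix v :: "real \<times> real"
    obtain i :: nat where "max (fst v) (snd v) \<le> real i" using real_arch_simple by blast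
    then show "v \<in> (\<Union>i. ?A i)" by (auto simp: less_eq_prod_def)
  qed
  show "emeasure M (?A i) \<noteq> \<infinity>" for i using finite_measure.emeasure_finite[OF assms(1)] by simp
qed

text \<open>
  With standard normal margins the copula prescribes the joint distribution function, hence the joint law, namely the image under
  \<open>correlate\<close> of two independent standard normal variables. The residual \<open>E\<close> undoes that map and recovers the first of these two variables.
\<close>

lemma (in prob_space) gaussian_copula_residual:
  fixes U W :: "'a \<Rightarrow> real"
  assumes \<rho>: "\<bar>\<rho>\<bar> < 1" and [measurable]: "random_variable borel U" "random_variable borel W"
    and cop: "has_copula M U W (gaussian_copula \<rho>)"
    and U: "distr M borel U = std_normal_distribution" and W: "distr M borel W = std_normal_distribution"
  defines "E \<equiv> \<lambda>\<omega>. (U \<omega> - \<rho> * W \<omega>) / sqrt (1 - \<rho>\<^sup>2)"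
  shows "distr M borel E = std_normal_distribution" "indep_var borel W borel E"
proof -
  let ?N = "std_normal_distribution" and ?s = "sqrt (1 - \<rho>\<^sup>2)"
  have s: "?s > 0" using \<rho> by (simp add: abs_square_less_1)
  interpret N: real_distribution ?N by (rule real_dist_normal_dist)
  interpret P: pair_prob_space ?N ?N ..
  have [measurable]: "random_variable borel E" unfolding E_def by measurable
  have cm: "correlate \<rho> \<in> ?N \<Otimes>\<^sub>M ?N \<rightarrow>\<^sub>M borel \<Otimes>\<^sub>M borel"
    using correlate_measurable by (simp cong: measurable_cong_sets sets_pair_measure_cong)
  interpret J: prob_space "distr M (borel \<Otimes>\<^sub>M borel) (\<lambda>\<omega>. (U \<omega>, W \<omega>))" by (rule prob_space_distr) simp
  interpret D: prob_space "distr (?N \<Otimes>\<^sub>M ?N) (borel \<Otimes>\<^sub>M borel) (correlate \<rho>)" by (rule P.prob_space_distr) (rule cm)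
  have joint: "distr M (borel \<Otimes>\<^sub>M borel) (\<lambda>\<omega>. (U \<omega>, W \<omega>)) = distr (?N \<Otimes>\<^sub>M ?N) (borel \<Otimes>\<^sub>M borel) (correlate \<rho>)"
  proof (rule real_pair_measure_eqI_quadrants)
    fix x y
    have "measure (distr M (borel \<Otimes>\<^sub>M borel) (\<lambda>\<omega>. (U \<omega>, W \<omega>))) ({..x} \<times> {..y}) =
        measure M {\<omega> \<in> space M. U \<omega> \<le> x \<and> W \<omega> \<le> y}"
      by (subst measure_distr) (auto intro!: arg_cong[where f="measure M"])
    also have "\<dots> = binormal_cdf \<rho> x y"
      using cop unfolding has_copula_def U W gaussian_copula_at_normal_margins by simp
    finally show "emeasure (distr M (borel \<Otimes>\<^sub>M borel) (\<lambda>\<omega>. (U \<omega>, W \<omega>))) ({..x} \<times> {..y}) =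
        emeasure (distr (?N \<Otimes>\<^sub>M ?N) (borel \<Otimes>\<^sub>M borel) (correlate \<rho>)) ({..x} \<times> {..y})"
      by (simp add: J.emeasure_eq_measure D.emeasure_eq_measure binormal_cdf_eq_correlate[OF \<rho>])
  qed (auto simp: J.finite_measure_axioms)
  \<comment> \<open>The inverse of \<open>correlate\<close>, with the coordinates exchanged.\<close>
  define h where "h = (\<lambda>(u, w). (w, (u - \<rho> * w) / ?s))"
  have [measurable]: "h \<in> borel \<Otimes>\<^sub>M borel \<rightarrow>\<^sub>M borel \<Otimes>\<^sub>M borel" unfolding h_def by measurable
  have "distr M (borel \<Otimes>\<^sub>M borel) (\<lambda>\<omega>. (W \<omega>, E \<omega>)) =
      distr (distr M (borel \<Otimes>\<^sub>M borel) (\<lambda>\<omega>. (U \<omega>, W \<omega>))) (borel \<Otimes>\<^sub>M borel) h"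
    by (subst distr_distr) (auto simp: h_def E_def comp_def)
  also have "\<dots> = distr (?N \<Otimes>\<^sub>M ?N) (borel \<Otimes>\<^sub>M borel) (h \<circ> correlate \<rho>)"
    unfolding joint by (rule distr_distr) (simp, rule cm)
  also have "h \<circ> correlate \<rho> = (\<lambda>(z, w). (w, z))"
    using s by (auto simp: h_def correlate_def fun_eq_iff)
  also have "distr (?N \<Otimes>\<^sub>M ?N) (borel \<Otimes>\<^sub>M borel) (\<lambda>(z, w). (w, z)) = distr (?N \<Otimes>\<^sub>M ?N) (?N \<Otimes>\<^sub>M ?N) (\<lambda>(z, w). (w, z))"
    by (intro distr_cong) (auto cong: sets_pair_measure_cong)
  also have "\<dots> = ?N \<Otimes>\<^sub>M ?N" by (rule P.distr_pair_swap[symmetric])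
  finally have WE: "distr M (borel \<Otimes>\<^sub>M borel) (\<lambda>\<omega>. (W \<omega>, E \<omega>)) = ?N \<Otimes>\<^sub>M ?N" .
  have "distr M borel E = distr (distr M (borel \<Otimes>\<^sub>M borel) (\<lambda>\<omega>. (U \<omega>, W \<omega>))) borel (\<lambda>(u, w). (u - \<rho> * w) / ?s)"
    by (subst distr_distr) (auto simp: comp_def E_def)
  also have "\<dots> = distr (?N \<Otimes>\<^sub>M ?N) borel ((\<lambda>(u, w). (u - \<rho> * w) / ?s) \<circ> correlate \<rho>)"
    unfolding joint by (rule distr_distr) (simp, rule cm)
  also have "(\<lambda>(u, w). (u - \<rho> * w) / ?s) \<circ> correlate \<rho> = fst"
    using s by (auto simp: correlate_def fun_eq_iff)
  also have "distr (?N \<Otimes>\<^sub>M ?N) borel fst = distr (?N \<Otimes>\<^sub>M ?N) ?N fst" by (intro distr_cong) auto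
  also have "\<dots> = ?N" by (rule N.distr_pair_fst)
  finally show E: "distr M borel E = ?N" .
  show "indep_var borel W borel E"
    unfolding indep_var_distribution_eq using WE E W by simp
qed

section \<open>Innovations of a Markov process\<close>

text \<open>
  The Markov property makes the past \<open>F\<close> and the future value \<open>Z\<close> conditionally independent given \<open>X\<close>. With \<open>p\<close> the conditional probability of
  an event \<open>B\<close> of the past given \<open>X\<close>, the laws of \<open>(X, Z)\<close> under the weights \<open>indicator B\<close> and \<open>p\<close> therefore agree, first on
  rectangles and then everywhere. Hence \<open>B\<close> may be replaced by the function \<open>p\<close> of \<open>X\<close>, from which \<open>h X Z\<close> is independent by
  assumption.
\<close>

lemma (in prob_space) innovation_indep_of_past:
  fixes X Z :: "'a \<Rightarrow> real" and h :: "real \<Rightarrow> real \<Rightarrow> real"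
  assumes sub: "subalgebra M F" and X: "X \<in> borel_measurable F" and Z[measurable]: "random_variable borel Z"
    and markov: "\<And>A. A \<in> sets borel \<Longrightarrow> AE \<omega> in M.
          real_cond_exp M F (indicator (Z -` A \<inter> space M)) \<omega> =
          real_cond_exp M (vimage_algebra (space M) X borel) (indicator (Z -` A \<inter> space M)) \<omega>"
    and h[measurable]: "case_prod h \<in> borel_measurable (borel \<Otimes>\<^sub>M borel)"
    and ind: "indep_var borel X borel (\<lambda>\<omega>. h (X \<omega>) (Z \<omega>))"
  shows "indep_of_algebra F (\<lambda>\<omega>. h (X \<omega>) (Z \<omega>))"
proof -
  define e where "e \<omega> = h (X \<omega>) (Z \<omega>)" for \<omega>
  define V where "V = vimage_algebra (space M) X borel"
  have XM[measurable]: "X \<in> borel_measurable M" by (rule measurable_from_subalg[OF sub X])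
  have e[measurable]: "e \<in> borel_measurable M"
  proof -
    have "(\<lambda>\<omega>. case_prod h (X \<omega>, Z \<omega>)) \<in> borel_measurable M" by measurable
    then show ?thesis by (simp add: e_def[abs_def])
  qed
  have setsV: "sets V = {X -` A \<inter> space M | A. A \<in> sets borel}"
    unfolding V_def by (rule sets_vimage_algebra2) auto
  have spaceV: "space V = space M" by (simp add: V_def)
  have subV: "subalgebra M V" unfolding subalgebra_def setsV spaceV by auto
  have XV: "X \<in> borel_measurable V" unfolding V_def by (rule measurable_vimage_algebra1) auto
  interpret F: finite_measure_subalgebra M F by unfold_locales (rule sub)
  interpret V: finite_measure_subalgebra M V by unfold_locales (rule subV)
  have indV: "indep_of_algebra V e"
    unfolding indep_of_algebra_def
  proof (intro conjI ballI)
    fix B E assume "B \<in> sets V" "E \<in> sets (borel :: real measure)"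
    then obtain A where A: "A \<in> sets borel" "B = X -` A \<inter> space M" and E: "E \<in> sets borel" by (auto simp: setsV)
    have "prob ((\<lambda>\<omega>. (X \<omega>, e \<omega>)) -` (A \<times> E) \<inter> space M) = prob (X -` A \<inter> space M) * prob (e -` E \<inter> space M)"
      using indep_varD[OF ind A(1) E] by (simp add: e_def[abs_def])
    moreover have "(\<lambda>\<omega>. (X \<omega>, e \<omega>)) -` (A \<times> E) \<inter> space M = B \<inter> (e -` E \<inter> space M)" using A by auto
    ultimately show "prob (B \<inter> (e -` E \<inter> space M)) = prob B * prob (e -` E \<inter> space M)" using A by simp
  qed (use subV in auto)
  have "prob (B \<inter> (e -` E \<inter> space M)) = prob B * prob (e -` E \<inter> space M)"
    if B: "B \<in> sets F" and E[measurable]: "E \<in> sets borel" for B E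
  proof -
    have BM[measurable]: "B \<in> sets M" using B sub by (auto simp: subalgebra_def)
    define b where "b = (indicator B :: 'a \<Rightarrow> real)"
    have bF: "b \<in> borel_measurable F" using B by (simp add: b_def)
    have [measurable]: "b \<in> borel_measurable M" by (simp add: b_def)
    have ib: "integrable M b" by (rule integrable_const_bound[of _ 1]) (auto simp: b_def indicator_def)
    have bs: "\<bar>b \<omega>\<bar> \<le> 1" "0 \<le> b \<omega>" for \<omega> by (auto simp: b_def indicator_def)
    define p where "p = real_cond_exp M V b"
    have pV: "p \<in> borel_measurable V" by (simp add: p_def)
    have [measurable]: "p \<in> borel_measurable M" by (rule measurable_from_subalg[OF subV pV])
    have p0: "AE \<omega> in M. 0 \<le> p \<omega>" unfolding p_def using bs by (intro V.real_cond_exp_pos) auto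
    have ip: "integrable M p" "expectation p = prob B"
      unfolding p_def using V.real_cond_exp_int[OF ib] by (auto simp: b_def)
    define \<nu>1 where "\<nu>1 = distr (density M (\<lambda>\<omega>. ennreal (b \<omega>))) (borel \<Otimes>\<^sub>M borel) (\<lambda>\<omega>. (X \<omega>, Z \<omega>))"
    define \<nu>2 where "\<nu>2 = distr (density M (\<lambda>\<omega>. ennreal (p \<omega>))) (borel \<Otimes>\<^sub>M borel) (\<lambda>\<omega>. (X \<omega>, Z \<omega>))"
    have em: "emeasure (distr (density M (\<lambda>\<omega>. ennreal (f \<omega>))) (borel \<Otimes>\<^sub>M borel) (\<lambda>\<omega>. (X \<omega>, Z \<omega>))) D =
        ennreal (\<integral>\<omega>. f \<omega> * indicator D (X \<omega>, Z \<omega>) \<partial>M)"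
      if f: "integrable M f" "AE \<omega> in M. 0 \<le> f \<omega>" and D[measurable]: "D \<in> sets (borel \<Otimes>\<^sub>M borel)" for f D
    proof -
      have [measurable]: "f \<in> borel_measurable M" using f by auto
      have "emeasure (distr (density M (\<lambda>\<omega>. ennreal (f \<omega>))) (borel \<Otimes>\<^sub>M borel) (\<lambda>\<omega>. (X \<omega>, Z \<omega>))) D =
          emeasure (density M (\<lambda>\<omega>. ennreal (f \<omega>))) ((\<lambda>\<omega>. (X \<omega>, Z \<omega>)) -` D \<inter> space M)"
        by (subst emeasure_distr) auto
      also have "\<dots> = (\<integral>\<^sup>+\<omega>. ennreal (f \<omega>) * indicator ((\<lambda>\<omega>. (X \<omega>, Z \<omega>)) -` D \<inter> space M) \<omega> \<partial>M)"
        by (rule emeasure_density) measurable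
      also have "\<dots> = (\<integral>\<^sup>+\<omega>. ennreal (f \<omega> * indicator D (X \<omega>, Z \<omega>)) \<partial>M)"
        by (intro nn_integral_cong) (auto simp: indicator_def)
      also have "\<dots> = ennreal (\<integral>\<omega>. f \<omega> * indicator D (X \<omega>, Z \<omega>) \<partial>M)"
      proof (rule nn_integral_eq_integral)
        show "integrable M (\<lambda>\<omega>. f \<omega> * indicator D (X \<omega>, Z \<omega>))"
          by (rule Bochner_Integration.integrable_bound[OF f(1)]) (auto simp: indicator_def)
        show "AE \<omega> in M. 0 \<le> f \<omega> * indicator D (X \<omega>, Z \<omega>)" using f(2) by eventually_elim auto
      qed
      finally show ?thesis .
    qed
    have b0: "AE \<omega> in M. 0 \<le> b \<omega>" using bs by simp
    note em1 = em[OF ib b0, folded \<nu>1_def] and em2 = em[OF ip(1) p0, folded \<nu>2_def]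
    have "\<nu>1 = \<nu>2"
    proof (rule measure_eqI_generator_eq)
      let ?E = "{C \<times> A | C A. C \<in> sets (borel :: real measure) \<and> A \<in> sets (borel :: real measure)}"
      show "Int_stable ?E" by (rule Int_stable_pair_measure_generator)
      show "?E \<subseteq> Pow UNIV" by auto
      show "sets \<nu>1 = sigma_sets UNIV ?E" "sets \<nu>2 = sigma_sets UNIV ?E"
        by (simp_all add: \<nu>1_def \<nu>2_def sets_pair_measure)
      show "range (\<lambda>i::nat. UNIV) \<subseteq> ?E" by (auto intro!: exI[of _ UNIV])
      show "emeasure \<nu>1 UNIV \<noteq> \<infinity>" for i :: nat 
        using sets.top[of "(borel :: real measure) \<Otimes>\<^sub>M (borel :: real measure)"]
        by (subst em1) (auto simp: space_pair_measure)
      fix D assume "D \<in> ?E"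
      then obtain C A where D: "D = C \<times> A" and CA[measurable]: "C \<in> sets borel" "A \<in> sets borel" by auto
      define i where "i = (\<lambda>\<omega>. indicator C (X \<omega>) :: real)"
      define j where "j = (indicator (Z -` A \<inter> space M) :: 'a \<Rightarrow> real)"
      define q where "q = real_cond_exp M V j"
      have [measurable]: "i \<in> borel_measurable M" "j \<in> borel_measurable M" by (auto simp: i_def j_def)
      have iF: "i \<in> borel_measurable F" and iV: "i \<in> borel_measurable V"
        unfolding i_def using X XV by measurable
      have ij: "0 \<le> i \<omega>" "i \<omega> \<le> 1" "0 \<le> j \<omega>" "j \<omega> \<le> 1" for \<omega> by (auto simp: i_def j_def indicator_def)
      have intj: "integrable M j" by (rule integrable_const_bound[of _ 1]) (use ij in auto)
      have qV: "q \<in> borel_measurable V" by (simp add: q_def)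
      have [measurable]: "q \<in> borel_measurable M" by (rule measurable_from_subalg[OF subV qV])
      have iq: "integrable M q" unfolding q_def by (rule V.real_cond_exp_int(1)[OF intj])
      have small: "integrable M (\<lambda>\<omega>. f \<omega> * g \<omega>)" if "integrable M g" "f \<in> borel_measurable M" "\<And>\<omega>. \<bar>f \<omega>\<bar> \<le> 1" for f g :: "'a \<Rightarrow> real"
      proof (rule Bochner_Integration.integrable_bound[OF that(1)])
        show "(\<lambda>\<omega>. f \<omega> * g \<omega>) \<in> borel_measurable M" using that by measurable
        show "AE \<omega> in M. norm (f \<omega> * g \<omega>) \<le> norm (g \<omega>)" using that(3) by (auto simp: abs_mult intro!: mult_left_le_one_le AE_I2)
      qed
      \<comment> \<open>Project \<open>j\<close> on the past, replace that projection by \<open>q\<close> (Markov property), project \<open>b\<close> on \<open>X\<close>, and undo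
        the projection of \<open>j\<close>.\<close>
      have "(\<integral>\<omega>. b \<omega> * indicator D (X \<omega>, Z \<omega>) \<partial>M) = (\<integral>\<omega>. (b \<omega> * i \<omega>) * j \<omega> \<partial>M)"
        by (intro Bochner_Integration.integral_cong) (auto simp: D i_def j_def indicator_def)
      also have "\<dots> = (\<integral>\<omega>. (b \<omega> * i \<omega>) * real_cond_exp M F j \<omega> \<partial>M)"
      proof (rule F.real_cond_exp_intg(2)[symmetric])
        have "\<bar>b \<omega> * i \<omega>\<bar> \<le> 1" for \<omega> using bs[of \<omega>] ij[of \<omega>] by (simp add: abs_mult mult_le_one)
        then show "integrable M (\<lambda>\<omega>. b \<omega> * i \<omega> * j \<omega>)" by (intro small intj) auto
      qed (use bF iF in auto)
      also have "\<dots> = (\<integral>\<omega>. (i \<omega> * q \<omega>) * b \<omega> \<partial>M)"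
      proof (rule integral_cong_AE)
        have fb: "real_cond_exp M F j \<in> borel_measurable M" by (simp add: borel_measurable_cond_exp2)
        then show "(\<lambda>\<omega>. b \<omega> * i \<omega> * real_cond_exp M F j \<omega>) \<in> borel_measurable M" by measurable
        show "AE \<omega> in M. b \<omega> * i \<omega> * real_cond_exp M F j \<omega> = i \<omega> * q \<omega> * b \<omega>"
          using markov[OF CA(2)] unfolding q_def j_def V_def by eventually_elim simp
      qed measurable
      also have "\<dots> = (\<integral>\<omega>. (i \<omega> * q \<omega>) * p \<omega> \<partial>M)"
        unfolding p_def
      proof (rule V.real_cond_exp_intg(2)[symmetric])
        have "integrable M (\<lambda>\<omega>. b \<omega> * (i \<omega> * q \<omega>))"
          by (intro small iq) (use bs ij in auto)
        then show "integrable M (\<lambda>\<omega>. i \<omega> * q \<omega> * b \<omega>)" by (simp add: mult_ac)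
        show "(\<lambda>\<omega>. i \<omega> * q \<omega>) \<in> borel_measurable V" using iV qV by measurable
      qed measurable
      also have "\<dots> = (\<integral>\<omega>. (i \<omega> * p \<omega>) * q \<omega> \<partial>M)" by (simp add: mult_ac)
      also have "\<dots> = (\<integral>\<omega>. (i \<omega> * p \<omega>) * j \<omega> \<partial>M)"
        unfolding q_def
      proof (rule V.real_cond_exp_intg(2))
        have "integrable M (\<lambda>\<omega>. j \<omega> * (i \<omega> * p \<omega>))"
          by (intro small ip) (use ij in auto)
        then show "integrable M (\<lambda>\<omega>. i \<omega> * p \<omega> * j \<omega>)" by (simp add: mult_ac)
        show "(\<lambda>\<omega>. i \<omega> * p \<omega>) \<in> borel_measurable V" using iV pV by measurable
      qed measurable
      also have "\<dots> = (\<integral>\<omega>. p \<omega> * indicator D (X \<omega>, Z \<omega>) \<partial>M)"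
        by (intro Bochner_Integration.integral_cong) (auto simp: D i_def j_def indicator_def)
      finally show "emeasure \<nu>1 D = emeasure \<nu>2 D" by (simp add: D em1 em2)
    qed auto
    moreover define D where "D = case_prod h -` E"
    have D[measurable]: "D \<in> sets (borel \<Otimes>\<^sub>M borel)"
      using measurable_sets[OF h E] by (simp add: D_def space_pair_measure)
    ultimately have "ennreal (\<integral>\<omega>. b \<omega> * indicator D (X \<omega>, Z \<omega>) \<partial>M) = ennreal (\<integral>\<omega>. p \<omega> * indicator D (X \<omega>, Z \<omega>) \<partial>M)"
      using em1[OF D] em2[OF D] by simp
    moreover have "0 \<le> (\<integral>\<omega>. p \<omega> * indicator D (X \<omega>, Z \<omega>) \<partial>M)"
      by (rule integral_nonneg_AE) (use p0 in eventually_elim, auto)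
    ultimately have eq: "(\<integral>\<omega>. b \<omega> * indicator D (X \<omega>, Z \<omega>) \<partial>M) = (\<integral>\<omega>. p \<omega> * indicator D (X \<omega>, Z \<omega>) \<partial>M)"
      using bs by (simp add: ennreal_inj integral_nonneg_AE)
    have De: "indicator D (X \<omega>, Z \<omega>) = (indicator E (e \<omega>) :: real)" for \<omega>
      by (auto simp: D_def e_def indicator_def)
    have "prob (B \<inter> (e -` E \<inter> space M)) = (\<integral>\<omega>. indicator (B \<inter> (e -` E \<inter> space M)) \<omega> \<partial>M)" by simp
    also have "\<dots> = (\<integral>\<omega>. b \<omega> * indicator E (e \<omega>) \<partial>M)"
      by (intro Bochner_Integration.integral_cong) (auto simp: b_def indicator_def)
    also have "\<dots> = (\<integral>\<omega>. p \<omega> * indicator E (e \<omega>) \<partial>M)" using eq by (simp add: De)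
    also have "\<dots> = expectation p * (\<integral>\<omega>. indicator E (e \<omega>) \<partial>M)"
    proof (rule indep_var_lebesgue_integral)
      show "indep_var borel p borel (\<lambda>\<omega>. indicator E (e \<omega>) :: real)"
        using indep_var_compose[OF indep_of_algebra_imp_indep_var[OF indV pV], of "\<lambda>x. x" borel "indicator E" borel]
        by (simp add: comp_def)
      show "integrable M (\<lambda>\<omega>. indicator E (e \<omega>) :: real)"
        by (rule integrable_const_bound[of _ 1]) (auto simp: indicator_def)
    qed (rule ip)
    also have "(\<integral>\<omega>. indicator E (e \<omega>) \<partial>M) = (\<integral>\<omega>. indicator (e -` E \<inter> space M) \<omega> \<partial>M)"
      by (intro Bochner_Integration.integral_cong) (auto simp: indicator_def)
    also have "\<dots> = prob (e -` E \<inter> space M)" by simp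
    finally show ?thesis using ip by simp
  qed
  then show ?thesis using sub e unfolding indep_of_algebra_def e_def[abs_def] by auto
qed

section \<open>Normal laws\<close>

context prob_space
begin

lemma distributed_std_normal_iff:
  assumes [measurable]: "random_variable borel X"
  shows "distributed M lborel X std_normal_density \<longleftrightarrow> distr M borel X = std_normal_distribution"
proof -
  have "distr M lborel X = distr M borel X" by (rule distr_cong) auto
  then show ?thesis by (auto simp: distributed_def)
qed

lemma distributed_cong_AE:
  assumes "distributed M lborel X f" "AE \<omega> in M. X \<omega> = X' \<omega>" "random_variable borel X'"
  shows "distributed M lborel X' f"
proof -
  have "distr M lborel X = distr M lborel X'"
    using assms distributed_measurable[OF assms(1)] by (intro distr_cong_AE) auto
  then show ?thesis using assms by (simp add: distributed_def)
qed

lemma indep_normal_combination: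
  assumes ind: "indep_var borel W borel E" and \<tau>: "\<tau> > 0"
    and W: "distributed M lborel W std_normal_density" and E: "distributed M lborel E std_normal_density"
  shows "distributed M lborel (\<lambda>\<omega>. A * W \<omega> + \<tau> * E \<omega>) (normal_density 0 (sqrt (A\<^sup>2 + \<tau>\<^sup>2)))"
proof -
  have \<tau>E: "distributed M lborel (\<lambda>\<omega>. \<tau> * E \<omega>) (normal_density 0 \<tau>)"
    using normal_density_affine[OF E, of \<tau> 0] \<tau> by simp
  show ?thesis
  proof (cases "A = 0")
    case True then show ?thesis using \<tau>E \<tau> by simp
  next
    case False
    have "distributed M lborel (\<lambda>\<omega>. A * W \<omega>) (normal_density 0 \<bar>A\<bar>)"
      using normal_density_affine[OF W, of A 0] False by simp
    moreover have "indep_var borel (\<lambda>\<omega>. A * W \<omega>) borel (\<lambda>\<omega>. \<tau> * E \<omega>)"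
      using indep_var_compose[OF ind, of "\<lambda>x. A * x" borel "\<lambda>x. \<tau> * x" borel] by (simp add: comp_def)
    ultimately show ?thesis using add_indep_normal[OF _ _ _ _ \<tau>E, of "\<lambda>\<omega>. A * W \<omega>" "\<bar>A\<bar>" 0] False \<tau> by simp
  qed
qed

lemma has_copula_scale:
  assumes cop: "has_copula M X Z C" and pos: "a > 0" "b > 0"
    and [measurable]: "random_variable borel X" "random_variable borel Z"
  shows "has_copula M (\<lambda>\<omega>. X \<omega> / a) (\<lambda>\<omega>. Z \<omega> / b) C"
  unfolding has_copula_def
proof (intro allI)
  fix x z
  have cdf: "cdf (distr M borel (\<lambda>\<omega>. V \<omega> / k)) y = cdf (distr M borel V) (k * y)"
    if [measurable]: "random_variable borel V" and "k > 0" for V and k y :: real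
    unfolding cdf_def using \<open>k > 0\<close>
    by (simp add: measure_distr vimage_def pos_divide_le_eq mult.commute)
  have "{\<omega> \<in> space M. X \<omega> / a \<le> x \<and> Z \<omega> / b \<le> z} = {\<omega> \<in> space M. X \<omega> \<le> a * x \<and> Z \<omega> \<le> b * z}"
    using pos by (auto simp: pos_divide_le_eq mult.commute)
  then show "prob {\<omega> \<in> space M. X \<omega> / a \<le> x \<and> Z \<omega> / b \<le> z} =
      C (cdf (distr M borel (\<lambda>\<omega>. X \<omega> / a)) x) (cdf (distr M borel (\<lambda>\<omega>. Z \<omega> / b)) z)"
    using cop pos by (simp add: cdf has_copula_def)
qed

end

lemma char_normal_zero_mean:
  assumes "\<eta> > 0"
  shows "real_distribution (density lborel (normal_density 0 \<eta>))"
    "char (density lborel (normal_density 0 \<eta>)) u = complex_of_real (exp (- ((u * \<eta>)\<^sup>2 / 2)))"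
proof -
  interpret N: real_distribution std_normal_distribution by (rule real_dist_normal_dist)
  have "distributed std_normal_distribution lborel (\<lambda>x. x) std_normal_density"
    by (subst N.distributed_std_normal_iff) (auto simp: distr_id2)
  then have D: "distributed std_normal_distribution lborel (\<lambda>x. \<eta> * x) (normal_density 0 \<eta>)"
    using N.normal_density_affine[of "\<lambda>x. x" 0 1 \<eta> 0] assms by simp
  have eq: "density lborel (normal_density 0 \<eta>) = distr std_normal_distribution lborel (\<lambda>x. \<eta> * x)"
    by (rule distributed_distr_eq_density[OF D, symmetric])
  show "real_distribution (density lborel (normal_density 0 \<eta>))"
    unfolding real_distribution_def real_distribution_axioms_def
    using prob_space_normal_density[OF assms] by auto
  have "char (density lborel (normal_density 0 \<eta>)) u = char std_normal_distribution (u * \<eta>)"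
    unfolding eq char_def by (subst integral_distr) (auto simp: mult_ac)
  then show "char (density lborel (normal_density 0 \<eta>)) u = complex_of_real (exp (- ((u * \<eta>)\<^sup>2 / 2)))"
    by (simp add: char_std_normal_distribution)
qed

section \<open>The recursion of the standard deviations\<close>

text \<open>
  The initial value has index 0 but belongs to time 1: \<open>volatility \<phi> \<rho> \<sigma> n\<close> is the standard deviation of \<open>Y (Suc n)\<close>
  (\<open>std_dev_Y\<close>), because \<open>Y 0\<close> vanishes.
\<close>

primrec volatility :: "real \<Rightarrow> real \<Rightarrow> real \<Rightarrow> nat \<Rightarrow> real" where
  "volatility \<phi> \<rho> \<sigma> 0 = \<sigma>"
| "volatility \<phi> \<rho> \<sigma> (Suc n) = sqrt ((\<phi> * volatility \<phi> \<rho> \<sigma> n + \<rho> * \<sigma>)\<^sup>2 + (\<sigma> * sqrt (1 - \<rho>\<^sup>2))\<^sup>2)"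

lemma V_bar_pos:
  assumes "\<bar>\<phi>\<bar> < 1" "\<sigma> > 0" shows "V_bar \<sigma> \<rho> \<phi> > 0"
proof -
  have p: "1 - \<phi>\<^sup>2 > 0" using assms by (simp add: abs_square_less_1)
  have "\<bar>\<rho> * \<phi>\<bar> = sqrt ((\<rho> * \<phi>)\<^sup>2)" by simp
  also have "\<dots> < sqrt (\<rho>\<^sup>2 * \<phi>\<^sup>2 + 1 - \<phi>\<^sup>2)"
    using p by (intro real_sqrt_less_mono) (simp add: power_mult_distrib)
  finally have "\<rho> * \<phi> + sqrt (\<rho>\<^sup>2 * \<phi>\<^sup>2 + 1 - \<phi>\<^sup>2) > 0" by linarith
  then show ?thesis unfolding V_bar_def using p assms by simp
qed

lemma V_bar_fixed_point:
  assumes "\<bar>\<phi>\<bar> < 1" "\<bar>\<rho>\<bar> < 1"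
  shows "(\<phi> * V_bar \<sigma> \<rho> \<phi> + \<rho> * \<sigma>)\<^sup>2 + (\<sigma> * sqrt (1 - \<rho>\<^sup>2))\<^sup>2 = (V_bar \<sigma> \<rho> \<phi>)\<^sup>2"
proof -
  let ?V = "V_bar \<sigma> \<rho> \<phi>" and ?k = "1 - \<phi>\<^sup>2"
  have k: "?k > 0" and r: "1 - \<rho>\<^sup>2 > 0" using assms by (simp_all add: abs_square_less_1)
  have nn: "0 \<le> \<rho>\<^sup>2 * \<phi>\<^sup>2 + 1 - \<phi>\<^sup>2" using k zero_le_power2[of "\<rho> * \<phi>"] unfolding power_mult_distrib by linarith
  have k0: "?k \<noteq> 0" using k by linarith
  have "?V * ?k = \<sigma> * (\<rho> * \<phi> + sqrt (\<rho>\<^sup>2 * \<phi>\<^sup>2 + 1 - \<phi>\<^sup>2))"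
    unfolding V_bar_def by (simp only: times_divide_eq_left nonzero_mult_div_cancel_right[OF k0])
  then have "?V * ?k - \<sigma> * \<rho> * \<phi> = \<sigma> * sqrt (\<rho>\<^sup>2 * \<phi>\<^sup>2 + 1 - \<phi>\<^sup>2)"
    by (simp only: distrib_left mult.assoc add_diff_cancel_left')
  then have "(?V * ?k - \<sigma> * \<rho> * \<phi>)\<^sup>2 = \<sigma>\<^sup>2 * (\<rho>\<^sup>2 * \<phi>\<^sup>2 + 1 - \<phi>\<^sup>2)"
    using nn by (simp add: power_mult_distrib)
  then have "?k * (?V\<^sup>2 * ?k - 2 * \<sigma> * \<rho> * \<phi> * ?V - \<sigma>\<^sup>2) = 0"
    by (simp add: power2_eq_square algebra_simps)
  then have "?V\<^sup>2 * ?k - 2 * \<sigma> * \<rho> * \<phi> * ?V - \<sigma>\<^sup>2 = 0" using k by simp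
  then show ?thesis using r by (simp add: power_mult_distrib) (simp add: power2_eq_square algebra_simps)
qed

lemma volatility_pos:
  assumes "\<sigma> > 0" "\<bar>\<rho>\<bar> < 1" shows "volatility \<phi> \<rho> \<sigma> n > 0"
proof (cases n)
  case (Suc m)
  have "\<rho>\<^sup>2 < 1" using assms by (simp add: abs_square_less_1)
  then have "0 < (\<sigma> * sqrt (1 - \<rho>\<^sup>2))\<^sup>2" using assms by simp
  then show ?thesis unfolding Suc volatility.simps by (intro real_sqrt_gt_zero add_nonneg_pos) auto
qed (use assms in simp)

text \<open>
  As the norm of the point \<open>(x, t)\<close>, \<open>sqrt (x\<^sup>2 + t\<^sup>2)\<close> is a 1-Lipschitz function of \<open>x\<close>. So the recursion is a contraction with
  factor \<open>\<bar>\<phi>\<bar>\<close>.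
\<close>

lemma volatility_tendsto:
  assumes "\<bar>\<phi>\<bar> < 1" "\<bar>\<rho>\<bar> < 1" "\<sigma> > 0"
  shows "volatility \<phi> \<rho> \<sigma> \<longlonglongrightarrow> V_bar \<sigma> \<rho> \<phi>"
proof -
  let ?V = "V_bar \<sigma> \<rho> \<phi>" and ?\<tau> = "\<sigma> * sqrt (1 - \<rho>\<^sup>2)"
  have lip: "\<bar>sqrt (x\<^sup>2 + t\<^sup>2) - sqrt (y\<^sup>2 + t\<^sup>2)\<bar> \<le> \<bar>x - y\<bar>" for x y t :: real
    using norm_triangle_ineq3[of "Complex x t" "Complex y t"] by (simp add: cmod_def)
  have V: "?V = sqrt ((\<phi> * ?V + \<rho> * \<sigma>)\<^sup>2 + ?\<tau>\<^sup>2)"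
    using V_bar_fixed_point[OF assms(1,2), of \<sigma>] V_bar_pos[OF assms(1,3), of \<rho>] by simp
  have "\<bar>volatility \<phi> \<rho> \<sigma> n - ?V\<bar> \<le> \<bar>\<phi>\<bar> ^ n * \<bar>\<sigma> - ?V\<bar>" for n
  proof (induction n)
    case (Suc n)
    have "\<bar>volatility \<phi> \<rho> \<sigma> (Suc n) - ?V\<bar> \<le> \<bar>(\<phi> * volatility \<phi> \<rho> \<sigma> n + \<rho> * \<sigma>) - (\<phi> * ?V + \<rho> * \<sigma>)\<bar>"
      by (subst V) (simp only: volatility.simps lip)
    also have "\<dots> = \<bar>\<phi>\<bar> * \<bar>volatility \<phi> \<rho> \<sigma> n - ?V\<bar>"
      by (simp add: algebra_simps flip: abs_mult)
    also have "\<dots> \<le> \<bar>\<phi>\<bar> * (\<bar>\<phi>\<bar> ^ n * \<bar>\<sigma> - ?V\<bar>)" by (intro mult_left_mono Suc) auto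
    finally show ?case by simp
  qed simp
  moreover have "(\<lambda>n. \<bar>\<phi>\<bar> ^ n * \<bar>\<sigma> - ?V\<bar>) \<longlonglongrightarrow> 0"
    using assms(1) by (intro tendsto_mult_left_zero LIMSEQ_power_zero) simp
  ultimately have "(\<lambda>n. volatility \<phi> \<rho> \<sigma> n - ?V) \<longlonglongrightarrow> 0"
    by (intro Lim_null_comparison[OF _ \<open>(\<lambda>n. \<bar>\<phi>\<bar> ^ n * \<bar>\<sigma> - ?V\<bar>) \<longlonglongrightarrow> 0\<close>]) (auto intro: always_eventually)
  then show ?thesis by (rule LIM_zero_cancel)
qed

section \<open>The DIG-AR(1) process and its infeasible estimator\<close>

text \<open>
  Scaling by positive constants does not change a copula, so the standardised innovation and the standardised \<open>Y (Suc n)\<close>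
  still have the gaussian one, and \<open>e\<close> is almost surely the residual of \<open>gaussian_copula_residual\<close>. The definition of \<open>e\<close> from \<open>Y\<close> instead of \<open>\<xi>\<close> makes the recursion for \<open>Y\<close> hold everywhere and
  not just almost surely.
\<close>

lemma (in dig_ar1) copula_innovation:
  fixes V :: real and n :: nat
  defines "\<tau> \<equiv> \<sigma> * sqrt (1 - \<rho>\<^sup>2)"
  defines "e \<equiv> \<lambda>\<omega>. (Y (Suc (Suc n)) \<omega> - (\<phi> + \<rho> * \<sigma> / V) * Y (Suc n) \<omega>) / \<tau>"
  assumes V: "V > 0" and Yn: "distributed M lborel (Y (Suc n)) (normal_density 0 V)"
  shows "distr M borel e = std_normal_distribution"
    and "indep_var borel (Y (Suc n)) borel e"
    and "distributed M lborel (Y (Suc (Suc n))) (normal_density 0 (sqrt ((\<phi> * V + \<rho> * \<sigma>)\<^sup>2 + \<tau>\<^sup>2)))"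
proof -
  note [measurable] = Y_measurable
  have \<tau>: "\<tau> > 0" using rho sigma by (simp add: \<tau>_def abs_square_less_1)
  have inn: "distributed M lborel (\<xi> (Suc (Suc n))) (normal_density 0 \<sigma>)" by (rule innovations) simp
  have [measurable]: "random_variable borel (\<xi> (Suc (Suc n)))"
    using distributed_measurable[OF inn] by simp
  have [measurable]: "random_variable borel e" unfolding e_def by measurable
  define U where "U \<omega> = \<xi> (Suc (Suc n)) \<omega> / \<sigma>" for \<omega>
  define W where "W \<omega> = Y (Suc n) \<omega> / V" for \<omega>
  have UW[measurable]: "random_variable borel U" "random_variable borel W"
    unfolding U_def[abs_def] W_def[abs_def] by measurable
  have dU: "distributed M lborel U std_normal_density"
    using inn normal_standard_normal_convert[OF sigma, of "\<xi> (Suc (Suc n))" 0] by (simp add: U_def[abs_def])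
  have dW: "distributed M lborel W std_normal_density"
    using Yn normal_standard_normal_convert[OF V, of "Y (Suc n)" 0] by (simp add: W_def[abs_def])
  have "has_copula M (\<xi> (Suc (Suc n))) (Y (Suc n)) (gaussian_copula \<rho>)" using copula[of "Suc (Suc n)"] by simp
  then have cop: "has_copula M U W (gaussian_copula \<rho>)"
    unfolding U_def[abs_def] W_def[abs_def] by (rule has_copula_scale) (use sigma V in auto)
  define E where "E \<omega> = (U \<omega> - \<rho> * W \<omega>) / sqrt (1 - \<rho>\<^sup>2)" for \<omega>
  have [measurable]: "random_variable borel E" unfolding E_def[abs_def] by measurable
  have "distr M borel U = std_normal_distribution" "distr M borel W = std_normal_distribution"
    using dU dW UW by (simp_all add: distributed_std_normal_iff)
  note residual = gaussian_copula_residual[OF rho UW cop this, folded E_def]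
  have E: "distr M borel E = std_normal_distribution" "indep_var borel W borel E"
    by (rule residual)+
  have ae: "AE \<omega> in M. e \<omega> = E \<omega>"
  proof -
    have "AE \<omega> in M. Y (Suc (Suc n)) \<omega> = \<phi> * Y (Suc n) \<omega> + \<xi> (Suc (Suc n)) \<omega>"
      using Y_step[of "Suc (Suc n)"] by simp
    then show ?thesis
    proof eventually_elim
      case (elim \<omega>)
      have "\<sigma> * U \<omega> = \<xi> (Suc (Suc n)) \<omega>" using sigma by (simp add: U_def)
      moreover have "(\<phi> + \<rho> * \<sigma> / V) * Y (Suc n) \<omega> = \<phi> * Y (Suc n) \<omega> + \<rho> * \<sigma> * W \<omega>"
        by (simp add: W_def distrib_right)
      moreover have "\<sigma> * (U \<omega> - \<rho> * W \<omega>) = \<sigma> * U \<omega> - \<rho> * \<sigma> * W \<omega>" by (simp add: algebra_simps)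
      ultimately have num: "Y (Suc (Suc n)) \<omega> - (\<phi> + \<rho> * \<sigma> / V) * Y (Suc n) \<omega> = \<sigma> * (U \<omega> - \<rho> * W \<omega>)"
        using elim by linarith
      have "\<sigma> \<noteq> 0" using sigma by simp
      then show ?case
        unfolding e_def E_def \<tau>_def num by (rule mult_divide_mult_cancel_left)
    qed
  qed
  have "distr M borel e = distr M borel E" by (rule distr_cong_AE) (use ae in auto)
  then show e: "distr M borel e = std_normal_distribution" using E by simp
  have "distr M (borel \<Otimes>\<^sub>M borel) (\<lambda>\<omega>. (W \<omega>, e \<omega>)) = distr M (borel \<Otimes>\<^sub>M borel) (\<lambda>\<omega>. (W \<omega>, E \<omega>))"
    by (rule distr_cong_AE) (use ae in auto)
  then have ind: "indep_var borel W borel e"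
    using E(2) unfolding indep_var_distribution_eq E(1) e by simp
  have "indep_var borel ((\<lambda>x. V * x) \<circ> W) borel ((\<lambda>x. x) \<circ> e)"
    by (rule indep_var_compose[OF ind]) simp_all
  moreover have "(\<lambda>x. V * x) \<circ> W = Y (Suc n)" using V by (auto simp: W_def fun_eq_iff)
  moreover have "(\<lambda>x. x) \<circ> e = e" by (rule ext) (simp only: comp_apply)
  ultimately show "indep_var borel (Y (Suc n)) borel e" by (simp only:)
  have "distributed M lborel (\<lambda>\<omega>. (\<phi> * V + \<rho> * \<sigma>) * W \<omega> + \<tau> * e \<omega>) (normal_density 0 (sqrt ((\<phi> * V + \<rho> * \<sigma>)\<^sup>2 + \<tau>\<^sup>2)))"
    by (rule indep_normal_combination[OF ind \<tau> dW]) (use e in \<open>simp add: distributed_std_normal_iff\<close>)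
  moreover have "(\<phi> * V + \<rho> * \<sigma>) * W \<omega> + \<tau> * e \<omega> = Y (Suc (Suc n)) \<omega>" for \<omega>
    using V \<tau> by (simp add: W_def e_def field_simps)
  ultimately show "distributed M lborel (Y (Suc (Suc n))) (normal_density 0 (sqrt ((\<phi> * V + \<rho> * \<sigma>)\<^sup>2 + \<tau>\<^sup>2)))"
    by simp
qed

lemma (in dig_ar1) Y_normal:
  "distributed M lborel (Y (Suc n)) (normal_density 0 (volatility \<phi> \<rho> \<sigma> n))"
proof (induction n)
  case 0
  have "AE \<omega> in M. \<xi> 1 \<omega> = Y 1 \<omega>" 
  proof -
    have "AE \<omega> in M. Y 1 \<omega> = \<phi> * Y 0 \<omega> + \<xi> 1 \<omega>" using Y_step[of 1] by simp
    with Y_0 show ?thesis by eventually_elim simp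
  qed
  then show ?case using distributed_cong_AE[OF innovations[of 1] _ Y_measurable] by simp
next
  case (Suc n)
  then show ?case using copula_innovation(3)[OF volatility_pos[OF sigma rho] Suc] by simp
qed

lemma (in dig_ar1) std_dev_Y: "std_dev M (Y (Suc n)) = volatility \<phi> \<rho> \<sigma> n"
  using normal_distributed_variance[OF volatility_pos[OF sigma rho] Y_normal[of n]] volatility_pos[OF sigma rho, of \<phi> n]
  by (simp add: std_dev_def)

context markov_dig_ar1
begin

abbreviation "v \<equiv> volatility \<phi> \<rho> \<sigma>"
abbreviation "\<tau> \<equiv> \<sigma> * sqrt (1 - \<rho>\<^sup>2)"
abbreviation "a \<equiv> \<phi> + \<rho> * \<sigma> / V_bar \<sigma> \<rho> \<phi>"
definition innovation :: "nat \<Rightarrow> 'a \<Rightarrow> real" where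
  "innovation n \<omega> = (Y (Suc (Suc n)) \<omega> - (\<phi> + \<rho> * \<sigma> / v n) * Y (Suc n) \<omega>) / \<tau>"

lemma natural_filtration_sets:
  "space (natural_filtration M Y t) = space M"
  "sets (natural_filtration M Y t) = sigma_sets (space M) {Y s -` A \<inter> space M | s A. s \<le> t \<and> A \<in> sets borel}"
  unfolding natural_filtration_def by (auto intro!: space_measure_of sets_measure_of)

lemma subalgebra_natural_filtration: "subalgebra M (natural_filtration M Y t)"
  unfolding subalgebra_def natural_filtration_sets
  using Y_measurable by (auto intro!: sets.sigma_sets_subset measurable_sets)

lemma natural_filtration_mono: "s \<le> t \<Longrightarrow> sets (natural_filtration M Y s) \<subseteq> sets (natural_filtration M Y t)"
  unfolding natural_filtration_sets by (rule sigma_sets_mono') (auto intro: order_trans)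

lemma Y_adapted: "s \<le> t \<Longrightarrow> Y s \<in> borel_measurable (natural_filtration M Y t)"
  by (rule measurableI) (auto simp: natural_filtration_sets intro!: sigma_sets.Basic)

lemma innovation_indep: "indep_of_algebra (natural_filtration M Y (Suc n)) (innovation n)"
proof -
  have "indep_of_algebra (natural_filtration M Y (Suc n))
      (\<lambda>\<omega>. (Y (Suc (Suc n)) \<omega> - (\<phi> + \<rho> * \<sigma> / v n) * Y (Suc n) \<omega>) / \<tau>)"
  proof (rule innovation_indep_of_past[where X = "Y (Suc n)" and Z = "Y (Suc (Suc n))" and
        h = "\<lambda>x z. (z - (\<phi> + \<rho> * \<sigma> / v n) * x) / \<tau>", OF subalgebra_natural_filtration Y_adapted Y_measurable])
    show "AE \<omega> in M. real_cond_exp M (natural_filtration M Y (Suc n)) (indicator (Y (Suc (Suc n)) -` A \<inter> space M)) \<omega> =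
        real_cond_exp M (vimage_algebra (space M) (Y (Suc n)) borel) (indicator (Y (Suc (Suc n)) -` A \<inter> space M)) \<omega>"
      if "A \<in> sets borel" for A
      using markov that unfolding markov_process_def by simp
    show "indep_var borel (Y (Suc n)) borel (\<lambda>\<omega>. (Y (Suc (Suc n)) \<omega> - (\<phi> + \<rho> * \<sigma> / v n) * Y (Suc n) \<omega>) / \<tau>)"
      by (rule copula_innovation(2)[OF volatility_pos[OF sigma rho] Y_normal])
  qed (simp, measurable)
  then show ?thesis by (simp add: innovation_def[abs_def])
qed

lemma \<tau>_pos: "\<tau> > 0" using rho sigma by (simp add: abs_square_less_1)

lemma Y_recursion: "Y (Suc (Suc n)) \<omega> = (\<phi> + \<rho> * \<sigma> / v n) * Y (Suc n) \<omega> + \<tau> * innovation n \<omega>"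
proof -
  have "\<tau> \<noteq> 0" using \<tau>_pos by linarith
  then have "\<tau> * innovation n \<omega> = Y (Suc (Suc n)) \<omega> - (\<phi> + \<rho> * \<sigma> / v n) * Y (Suc n) \<omega>"
    unfolding innovation_def times_divide_eq_right by (rule nonzero_mult_div_cancel_left)
  then show ?thesis by linarith
qed

lemma one_minus_a_squared: "1 - a\<^sup>2 = (eta_bar \<sigma> \<rho> \<phi>)\<^sup>2"
proof -
  have V: "V_bar \<sigma> \<rho> \<phi> > 0" by (rule V_bar_pos[OF phi sigma])
  have "a * V_bar \<sigma> \<rho> \<phi> = \<phi> * V_bar \<sigma> \<rho> \<phi> + \<rho> * \<sigma>" using V by (simp add: field_simps)
  then have "(a * V_bar \<sigma> \<rho> \<phi>)\<^sup>2 + \<tau>\<^sup>2 = (V_bar \<sigma> \<rho> \<phi>)\<^sup>2" using V_bar_fixed_point[OF phi rho, of \<sigma>] by (simp only:)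
  then have "(1 - a\<^sup>2) * (V_bar \<sigma> \<rho> \<phi>)\<^sup>2 = \<tau>\<^sup>2"
    unfolding power_mult_distrib[of a] left_diff_distrib by linarith
  then have "1 - a\<^sup>2 = \<tau>\<^sup>2 / (V_bar \<sigma> \<rho> \<phi>)\<^sup>2" using V by (simp add: eq_divide_eq)
  then show ?thesis by (simp add: eta_bar_def power_divide)
qed

lemma eta_bar_pos: "eta_bar \<sigma> \<rho> \<phi> > 0"
  using \<tau>_pos V_bar_pos[OF phi sigma, of \<rho>] by (simp add: eta_bar_def)

text \<open>
  From time 1 on, the process is an autoregression driven by standard normal noise. Index \<open>n\<close> of the recursion is
  time \<open>Suc n\<close> of the process.
\<close>

lemma bounded_recursion:
  obtains W where "gaussian_recursion M (\<lambda>n. natural_filtration M Y (Suc n)) innovation (\<lambda>n. Y (Suc n))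
      (\<lambda>n. \<phi> + \<rho> * \<sigma> / v n) \<tau> a W"
proof -
  note Vpos = V_bar_pos[OF phi sigma, of \<rho>] and vpos = volatility_pos[OF sigma rho, of \<phi>]
  note vlim = volatility_tendsto[OF phi rho sigma]
  obtain K where K: "\<And>n. \<bar>v n\<bar> \<le> K"
    using convergent_imp_Bseq[OF convergentI[OF vlim]] unfolding Bseq_def by auto
  have Y2: "integrable M (\<lambda>\<omega>. (Y (Suc n) \<omega>)\<^sup>2)" "expectation (\<lambda>\<omega>. (Y (Suc n) \<omega>)\<^sup>2) = (v n)\<^sup>2" for n
  proof -
    note D = Y_normal[of n]
    have "integrable lborel (\<lambda>x. normal_density 0 (v n) x * x\<^sup>2)"
      using integrable_normal_moment[where \<sigma> = "v n" and \<mu> = 0 and k = 2, OF vpos] by simp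
    then show "integrable M (\<lambda>\<omega>. (Y (Suc n) \<omega>)\<^sup>2)"
      using distributed_integrable[OF D, of "\<lambda>x. x\<^sup>2"] by simp
    show "expectation (\<lambda>\<omega>. (Y (Suc n) \<omega>)\<^sup>2) = (v n)\<^sup>2"
      using normal_distributed_variance[OF vpos D] normal_distributed_expectation[OF vpos D] by simp
  qed
  have "gaussian_recursion M (\<lambda>n. natural_filtration M Y (Suc n)) innovation (\<lambda>n. Y (Suc n))
      (\<lambda>n. \<phi> + \<rho> * \<sigma> / v n) \<tau> a (K\<^sup>2)"
  proof unfold_locales
    show "subalgebra M (natural_filtration M Y (Suc n))" for n by (rule subalgebra_natural_filtration)
    show "sets (natural_filtration M Y (Suc n)) \<subseteq> sets (natural_filtration M Y (Suc (Suc n)))" for n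
      by (rule natural_filtration_mono) simp
    show "Y (Suc n) \<in> borel_measurable (natural_filtration M Y (Suc n))" for n by (rule Y_adapted) simp
    show "innovation n \<in> borel_measurable (natural_filtration M Y (Suc (Suc n)))" for n
    proof -
      have [measurable]: "Y (Suc n) \<in> borel_measurable (natural_filtration M Y (Suc (Suc n)))"
        "Y (Suc (Suc n)) \<in> borel_measurable (natural_filtration M Y (Suc (Suc n)))" by (auto intro: Y_adapted)
      show ?thesis unfolding innovation_def[abs_def] by measurable
    qed
    show "indep_of_algebra (natural_filtration M Y (Suc n)) (innovation n)" for n by (rule innovation_indep)
    show "distr M borel (innovation n) = std_normal_distribution" for n
      unfolding innovation_def[abs_def] by (rule copula_innovation(1)[OF vpos Y_normal])
    show "integrable M (\<lambda>\<omega>. (Y (Suc n) \<omega>)\<^sup>2)" for n by (rule Y2)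
    show "expectation (\<lambda>\<omega>. (Y (Suc n) \<omega>)\<^sup>2) \<le> K\<^sup>2" for n
      unfolding Y2 using power_mono[OF K abs_ge_zero, of n 2] by simp
    show "Y (Suc (Suc n)) \<omega> = (\<phi> + \<rho> * \<sigma> / v n) * Y (Suc n) \<omega> + \<tau> * innovation n \<omega>" for n \<omega>
      by (rule Y_recursion)
    show "(\<lambda>n. \<phi> + \<rho> * \<sigma> / v n) \<longlonglongrightarrow> a"
      using Vpos by (intro tendsto_intros vlim) simp
    show "\<bar>a\<bar> < 1"
    proof -
      have "0 < (eta_bar \<sigma> \<rho> \<phi>)\<^sup>2" using eta_bar_pos by simp
      then have "a\<^sup>2 < 1" using one_minus_a_squared by linarith
      then show ?thesis by (simp add: abs_square_less_1)
    qed
    show "\<tau> > 0" by (rule \<tau>_pos)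
  qed
  then show thesis by (rule that)
qed

text \<open>
  The nonvanishing denominator matters: otherwise both estimators are 0, as quotients by 0, and the error
  is \<open>- \<phi>\<close>. That happens for the empty sum, but for \<open>N \<ge> 1\<close> only on a null set
  (\<open>sum_Y_squared_nonzero\<close>).
\<close>

lemma phi_tilde_error:
  assumes "(\<Sum>n<N. (Y (Suc n) \<omega>)\<^sup>2) \<noteq> 0"
  shows "phi_tilde M \<rho> \<sigma> Y (Suc N) \<omega> - \<phi> =
    \<tau> * (\<Sum>n<N. Y (Suc n) \<omega> * innovation n \<omega>) / (\<Sum>n<N. (Y (Suc n) \<omega>)\<^sup>2)"
proof -
  have shift: "(\<Sum>t=2..Suc N. f t) = (\<Sum>n<N. f (Suc (Suc n)))" for f :: "nat \<Rightarrow> real"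
    by (induction N) (auto simp: sum.cl_ivl_Suc)
  let ?Q = "\<Sum>n<N. (Y (Suc n) \<omega>)\<^sup>2"
  have "(\<Sum>n<N. Y (Suc (Suc n)) \<omega> * Y (Suc n) \<omega>) =
      (\<Sum>n<N. \<phi> * (Y (Suc n) \<omega>)\<^sup>2 + \<rho> * \<sigma> * ((Y (Suc n) \<omega>)\<^sup>2 / v n) + \<tau> * (Y (Suc n) \<omega> * innovation n \<omega>))"
  proof (rule sum.cong[OF refl])
    fix n
    show "Y (Suc (Suc n)) \<omega> * Y (Suc n) \<omega> =
        \<phi> * (Y (Suc n) \<omega>)\<^sup>2 + \<rho> * \<sigma> * ((Y (Suc n) \<omega>)\<^sup>2 / v n) + \<tau> * (Y (Suc n) \<omega> * innovation n \<omega>)"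
      unfolding Y_recursion[of n \<omega>] by (simp add: power2_eq_square algebra_simps)
  qed
  also have "\<dots> = \<phi> * ?Q + \<rho> * \<sigma> * (\<Sum>n<N. (Y (Suc n) \<omega>)\<^sup>2 / v n) + \<tau> * (\<Sum>n<N. Y (Suc n) \<omega> * innovation n \<omega>)"
    by (simp only: sum.distrib sum_distrib_left)
  finally have num: "(\<Sum>n<N. Y (Suc (Suc n)) \<omega> * Y (Suc n) \<omega>) = \<dots>" .
  have "phi_tilde M \<rho> \<sigma> Y (Suc N) \<omega> - \<phi> =
      (\<Sum>n<N. Y (Suc (Suc n)) \<omega> * Y (Suc n) \<omega>) / ?Q - \<rho> * \<sigma> * ((\<Sum>n<N. (Y (Suc n) \<omega>)\<^sup>2 / v n) / ?Q) - \<phi>"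
    unfolding phi_tilde_def phi_hat_def shift by (simp add: std_dev_Y)
  also have "\<dots> = \<tau> * (\<Sum>n<N. Y (Suc n) \<omega> * innovation n \<omega>) / ?Q"
    unfolding num using assms by (simp add: add_divide_distrib)
  finally show ?thesis .
qed

lemma sum_Y_squared_nonzero:
  assumes "N \<ge> 1" shows "AE \<omega> in M. (\<Sum>n<N. (Y (Suc n) \<omega>)\<^sup>2) \<noteq> 0"
proof -
  have D: "distr M lborel (Y 1) = density lborel (normal_density 0 \<sigma>)"
    using distributed_distr_eq_density[OF Y_normal[of 0]] by simp
  have "AE x in density lborel (normal_density 0 \<sigma>). x \<noteq> 0"
    by (subst AE_density) (auto intro: AE_mp[OF AE_lborel_singleton[of 0]])
  then have "AE \<omega> in M. Y 1 \<omega> \<noteq> 0"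
    unfolding D[symmetric] using Y_measurable by (subst (asm) AE_distr_iff) auto
  then show ?thesis
  proof eventually_elim
    case (elim \<omega>)
    have "0 < (Y (Suc 0) \<omega>)\<^sup>2" using elim by simp
    also have "\<dots> \<le> (\<Sum>n<N. (Y (Suc n) \<omega>)\<^sup>2)"
      using assms by (intro member_le_sum[of 0 "{..<N}" "\<lambda>n. (Y (Suc n) \<omega>)\<^sup>2"]) auto
    finally show ?case by simp
  qed
qed

theorem infeasible_estimator_weak_conv:
  "weak_conv_m
     (\<lambda>T. distr M borel (\<lambda>\<omega>. sqrt (real T) * (phi_tilde M \<rho> \<sigma> Y T \<omega> - \<phi>)))
     (density lborel (normal_density 0 (eta_bar \<sigma> \<rho> \<phi>)))"
proof (rule levy_continuity)
  note [measurable] = Y_measurable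
  have [measurable]: "phi_tilde M \<rho> \<sigma> Y T \<in> borel_measurable M" for T
    unfolding phi_tilde_def[abs_def] phi_hat_def by measurable
  show "real_distribution (distr M borel (\<lambda>\<omega>. sqrt (real T) * (phi_tilde M \<rho> \<sigma> Y T \<omega> - \<phi>)))" for T
    by (rule real_distribution_distr) measurable
  show "real_distribution (density lborel (normal_density 0 (eta_bar \<sigma> \<rho> \<phi>)))"
    by (rule char_normal_zero_mean(1)[OF eta_bar_pos])
  fix u
  obtain W where gr: "gaussian_recursion M (\<lambda>n. natural_filtration M Y (Suc n)) innovation (\<lambda>n. Y (Suc n))
      (\<lambda>n. \<phi> + \<rho> * \<sigma> / v n) \<tau> a W"
    by (rule bounded_recursion)
  interpret R: gaussian_recursion M "\<lambda>n. natural_filtration M Y (Suc n)" innovation "\<lambda>n. Y (Suc n)"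
      "\<lambda>n. \<phi> + \<rho> * \<sigma> / v n" \<tau> a W by (rule gr)
  \<comment> \<open>The sums up to \<open>T = Suc N\<close> start at 2 and have \<open>N\<close> terms.\<close>
  have eq: "distr M borel (\<lambda>\<omega>. sqrt (real (Suc N)) * (phi_tilde M \<rho> \<sigma> Y (Suc N) \<omega> - \<phi>)) =
      distr M borel (\<lambda>\<omega>. sqrt (real (Suc N)) * (\<tau> * R.S N \<omega> / R.Q N \<omega>))" if "N \<ge> 1" for N
  proof (rule distr_cong_AE)
    show "AE \<omega> in M. sqrt (real (Suc N)) * (phi_tilde M \<rho> \<sigma> Y (Suc N) \<omega> - \<phi>) =
        sqrt (real (Suc N)) * (\<tau> * R.S N \<omega> / R.Q N \<omega>)"
      using sum_Y_squared_nonzero[OF that] by eventually_elim (simp add: phi_tilde_error R.S_def R.Q_def)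
  qed auto
  have lim: "complex_of_real (exp (- (u\<^sup>2 * (1 - a\<^sup>2) / 2))) = char (density lborel (normal_density 0 (eta_bar \<sigma> \<rho> \<phi>))) u"
    by (simp add: char_normal_zero_mean(2)[OF eta_bar_pos] one_minus_a_squared power_mult_distrib)
  have "(\<lambda>N. char (distr M borel (\<lambda>\<omega>. sqrt (real (Suc N)) * (phi_tilde M \<rho> \<sigma> Y (Suc N) \<omega> - \<phi>))) u)
      \<longlonglongrightarrow> char (density lborel (normal_density 0 (eta_bar \<sigma> \<rho> \<phi>))) u"
    unfolding lim[symmetric]
  proof (rule Lim_transform_eventually[OF R.char_normalized_error])
    show "\<forall>\<^sub>F N in sequentially. char (distr M borel (\<lambda>\<omega>. sqrt (real (Suc N)) * (\<tau> * R.S N \<omega> / R.Q N \<omega>))) u =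
        char (distr M borel (\<lambda>\<omega>. sqrt (real (Suc N)) * (phi_tilde M \<rho> \<sigma> Y (Suc N) \<omega> - \<phi>))) u"
      using eventually_ge_at_top[of 1] by eventually_elim (simp only: eq)
  qed
  then show "(\<lambda>T. char (distr M borel (\<lambda>\<omega>. sqrt (real T) * (phi_tilde M \<rho> \<sigma> Y T \<omega> - \<phi>))) u)
      \<longlonglongrightarrow> char (density lborel (normal_density 0 (eta_bar \<sigma> \<rho> \<phi>))) u"
    by (rule LIMSEQ_imp_Suc)
qed

end

theorem theorem4p1:
  fixes M :: "'a measure" and \<phi> \<rho> \<sigma> :: real and Y \<xi> :: "nat \<Rightarrow> 'a \<Rightarrow> real"
  assumes "\<bar>\<phi>\<bar> < 1" and "\<bar>\<rho>\<bar> < 1" and "\<sigma> > 0"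
    and "markov_dig_ar1 M \<phi> \<rho> \<sigma> Y \<xi>"
  shows "weak_conv_m
           (\<lambda>T. distr M borel (\<lambda>\<omega>. sqrt (real T) * (phi_tilde M \<rho> \<sigma> Y T \<omega> - \<phi>)))
           (density lborel (normal_density 0 (eta_bar \<sigma> \<rho> \<phi>)))"
  by (rule markov_dig_ar1.infeasible_estimator_weak_conv[OF assms(4)])

end
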